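(* Let $\gamma\in[-1,1]$ and, for each $N\ge 1$, let $X=X_N$ be the normalized $N\times N$ real Gaussian elliptic matrix with parameter $\gamma$. Let $p,q\ge 1$ be integers. Then the following limits exist and are given as follows. (i) Pure powers and pure power versus adjoint power: $$\lim_{N\to\infty}\kappa_2\left(\operatorname{Tr} X^{p},\operatorname{Tr} X^{q}\right)=\lim_{N\to\infty}\kappa_2\left(\operatorname{Tr} X^{p},\operatorname{Tr} (X^{*})^{q}\right)=\sum_{a=1}^{\min\{p,q\}} a\,\gamma^{\frac{p+q}{2}-a}(\gamma^{a}+1)\binom{p}{\frac{p-a}{2}}\binom{q}{\frac{q-a}{2}},$$ where a summand in which $\frac{p-a}{2}$ or $\frac{q-a}{2}$ is not an integer is $0$. (ii) Alternating words: $$\lim_{N\to\infty}\kappa_2\left(\operatorname{Tr}(XX^{*})^{p},\operatorname{Tr}(XX^{*})^{q}\right)=\sum_{a=1}^{\min\{p,q\}} 2a\,(\gamma^{2a}+1)\binom{2p}{p-a}\binom{2q}{q-a}.$$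
   Context: A real Gaussian elliptic matrix of parameter $\gamma\in[-1,1]$ is a random matrix $(X_{ij})_{i,j=1}^N$ such that: (1) $\{X_{ii}:1\le i\le N\}\cup\{(X_{ij},X_{ji}):1\le i<j\le N\}$ is a collection of independent random elements; (2) the pairs $(X_{ij},X_{ji})$, $i<j$, are i.i.d. centered real Gaussian vectors with $\mathbb E X_{ij}^2=\mathbb E X_{ji}^2=1$ and $\mathbb E X_{ij}X_{ji}=\gamma$; (3) the $X_{ii}$ are i.i.d. centered real Gaussian with $\mathbb E X_{ii}^2=1+\gamma$. The normalized matrix is $X_N=\frac{1}{\sqrt N}(X_{ij})_{i,j=1}^N$. $\operatorname{Tr}$ is the unnormalized trace and $X^*=X^T$ is the transpose. $\kappa_2(\xi_1,\xi_2)=\mathbb E(\xi_1\xi_2)-\mathbb E(\xi_1)\mathbb E(\xi_2)$. Convention: $\binom{n}{x}=0$ if $x$ is not an integer, and $0^0=1$. *)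

theory Defs
  imports "HOL-Probability.Probability" "Jordan_Normal_Form.Matrix"
begin

(* Degenerate Gaussian laws are included: for gamma = 1 or gamma = -1 the pairs
   (X_ij, X_ji) are degenerate, and for gamma = -1 the diagonal vanishes almost surely. *)
definition gaussian_measure :: "real \<Rightarrow> real \<Rightarrow> real measure" where
  "gaussian_measure \<mu> \<sigma> =
     (if \<sigma> = 0 then return borel \<mu> else density lborel (\<lambda>x. ennreal (normal_density \<mu> \<sigma> x)))"

definition gaussian_rv :: "'a measure \<Rightarrow> ('a \<Rightarrow> real) \<Rightarrow> bool" where
  "gaussian_rv M Y \<longleftrightarrow>
     Y \<in> borel_measurable M \<and>
     (\<exists>\<mu> \<sigma>. \<sigma> \<ge> 0 \<and> distr M borel Y = gaussian_measure \<mu> \<sigma>)"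

definition gaussian_pair :: "'a measure \<Rightarrow> ('a \<Rightarrow> real) \<Rightarrow> ('a \<Rightarrow> real) \<Rightarrow> bool" where
  "gaussian_pair M Y Z \<longleftrightarrow> (\<forall>a b. gaussian_rv M (\<lambda>\<omega>. a * Y \<omega> + b * Z \<omega>))"

(* Unnormalized N x N elliptic matrix, with indices 0, ..., N - 1.  In the independence
   condition the diagonal entry X_ii is represented by the pair (X_ii, X_ii), which generates
   the same sigma-algebra, so that all members of the family take values in one type. *)
definition gaussian_elliptic :: "'a measure \<Rightarrow> real \<Rightarrow> nat \<Rightarrow> ('a \<Rightarrow> real mat) \<Rightarrow> bool" where
  "gaussian_elliptic M \<gamma> N X \<longleftrightarrow>
     prob_space M \<and>
     (\<forall>\<omega>\<in>space M. X \<omega> \<in> carrier_mat N N) \<and>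
     prob_space.indep_vars M (\<lambda>_. borel :: (real \<times> real) measure)
       (\<lambda>(i, j) \<omega>. (X \<omega> $$ (i, j), X \<omega> $$ (j, i))) {(i, j). i \<le> j \<and> j < N} \<and>
     (\<forall>i j. i < j \<and> j < N \<longrightarrow>
        gaussian_pair M (\<lambda>\<omega>. X \<omega> $$ (i, j)) (\<lambda>\<omega>. X \<omega> $$ (j, i)) \<and>
        integral\<^sup>L M (\<lambda>\<omega>. X \<omega> $$ (i, j)) = 0 \<and>
        integral\<^sup>L M (\<lambda>\<omega>. X \<omega> $$ (j, i)) = 0 \<and>
        integral\<^sup>L M (\<lambda>\<omega>. (X \<omega> $$ (i, j))\<^sup>2) = 1 \<and>
        integral\<^sup>L M (\<lambda>\<omega>. (X \<omega> $$ (j, i))\<^sup>2) = 1 \<and>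
        integral\<^sup>L M (\<lambda>\<omega>. X \<omega> $$ (i, j) * X \<omega> $$ (j, i)) = \<gamma>) \<and>
     (\<forall>i j k l. i < j \<and> j < N \<and> k < l \<and> l < N \<longrightarrow>
        distr M (borel :: (real \<times> real) measure) (\<lambda>\<omega>. (X \<omega> $$ (i, j), X \<omega> $$ (j, i))) =
        distr M borel (\<lambda>\<omega>. (X \<omega> $$ (k, l), X \<omega> $$ (l, k)))) \<and>
     (\<forall>i<N.
        gaussian_rv M (\<lambda>\<omega>. X \<omega> $$ (i, i)) \<and>
        integral\<^sup>L M (\<lambda>\<omega>. X \<omega> $$ (i, i)) = 0 \<and>
        integral\<^sup>L M (\<lambda>\<omega>. (X \<omega> $$ (i, i))\<^sup>2) = 1 + \<gamma>) \<and>
     (\<forall>i<N. \<forall>k<N.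
        distr M borel (\<lambda>\<omega>. X \<omega> $$ (i, i)) = distr M borel (\<lambda>\<omega>. X \<omega> $$ (k, k)))"

definition normalized_gaussian_elliptic ::
    "'a measure \<Rightarrow> real \<Rightarrow> nat \<Rightarrow> ('a \<Rightarrow> real mat) \<Rightarrow> bool" where
  "normalized_gaussian_elliptic M \<gamma> N X \<longleftrightarrow>
     (\<exists>Y. gaussian_elliptic M \<gamma> N Y \<and> (\<forall>\<omega>\<in>space M. X \<omega> = (1 / sqrt (real N)) \<cdot>\<^sub>m Y \<omega>))"

definition tr :: "'b :: comm_monoid_add mat \<Rightarrow> 'b" where
  "tr A = (\<Sum>i<dim_row A. A $$ (i, i))"

definition kappa2 :: "'a measure \<Rightarrow> ('a \<Rightarrow> real) \<Rightarrow> ('a \<Rightarrow> real) \<Rightarrow> real" where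
  "kappa2 M Y Z =
     integral\<^sup>L M (\<lambda>\<omega>. Y \<omega> * Z \<omega>) - integral\<^sup>L M Y * integral\<^sup>L M Z"

(* Binomial coefficient whose lower argument may be fractional; it is 0 unless that
   argument is a natural number. *)
definition binom :: "nat \<Rightarrow> real \<Rightarrow> real" where
  "binom n x = (if x \<in> \<nat> then real (n choose nat \<lfloor>x\<rfloor>) else 0)"

end

theory Submission
  imports Defs "HOL-Library.Landau_Symbols" "HOL-Computational_Algebra.Formal_Power_Series"
begin

text \<open>
  Gaussian integration by parts turns the expectation of a product of traces of words in \<open>X\<close> and
  its transpose into a sum over the letters paired with the first letter of the first word
  (Schwinger--Dyson equations). For products of centred traces every term has smaller total length,
  so by induction all these mixed moments are bounded in \<open>N\<close>, the normalized means converge, and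
  the covariances converge to the solution of a recursion on words: a letter pairs either inside its
  own trace, splitting it, or with a letter of the other trace, merging both into one word.

  For powers of \<open>X\<close> and for alternating words the merged word consists of two periodic blocks, so
  its limiting mean is a sum over the number of letters paired across the blocks, whose terms are
  products of ballot numbers. With \<open>c = 1 + g z\<^sup>2 c\<^sup>2\<close>, the ballot numbers have generating function
  \<open>z ^ k * c ^ (k + 1)\<close> and the binomial coefficients in the answer have generating function
  \<open>(z c) ^ a / (1 - 2 g z\<^sup>2 c)\<close>; the recursion for the covariances becomes an identity between these series.
\<close>

section \<open>Random variables with finite moments\<close>

text \<open>Each summand of the limit has a combinatorial origin. For large N a trace is a circle of
  letters and the surviving pairings are planar: non-crossing in a disc for a mean, in an annulus
  for a covariance. The index \<open>a\<close> is the number of pairs joining the two circles. They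
  are either all straight or all twisted, and for periodic words one choice gives every joining pair
  the weight \<gamma> and the other the weight 1. Hence the factor \<gamma>^a + 1, and hence the
  same limit for a power of X and of its transpose. What remains is one count for each circle and a
  factor \<open>a\<close> for the rotations that match them. Two obstacles shape the development. At
  \<gamma> = 1 and \<gamma> = -1 a pair of opposite entries has no joint density, so integration by
  parts is derived from moments of linear combinations. And the equation for a covariance does not
  close: it involves moments of three traces, so boundedness is proved for any number of traces at
  once.\<close>

definition finite_moments :: "'a measure \<Rightarrow> ('a \<Rightarrow> real) \<Rightarrow> bool" where
  "finite_moments M F \<longleftrightarrow> F \<in> borel_measurable M \<and> (\<forall>n. integrable M (\<lambda>\<omega>. F \<omega> ^ n))"

lemma finite_moments_measurable: "finite_moments M F \<Longrightarrow> F \<in> borel_measurable M"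
  by (simp add: finite_moments_def)

lemma finite_moments_integrable_power: "finite_moments M F \<Longrightarrow> integrable M (\<lambda>\<omega>. F \<omega> ^ n)"
  by (simp add: finite_moments_def)

lemma finite_moments_integrable: "finite_moments M F \<Longrightarrow> integrable M F"
  using finite_moments_integrable_power[of M F 1] by simp

text \<open>From |xy| \<le> x^2 + y^2 at x = F^k, y = G^l. Having all moments, unlike plain
  integrability, is therefore stable under products, so every polynomial in the entries is
  integrable.\<close>

lemma finite_moments_integrable_mono:
  assumes "finite_moments M F" "finite_moments M G"
  shows "integrable M (\<lambda>\<omega>. F \<omega> ^ k * G \<omega> ^ l)"
proof (rule Bochner_Integration.integrable_bound)
  show "integrable M (\<lambda>\<omega>. F \<omega> ^ (2 * k) + G \<omega> ^ (2 * l))"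
    using assms by (intro Bochner_Integration.integrable_add finite_moments_integrable_power)
  show "(\<lambda>\<omega>. F \<omega> ^ k * G \<omega> ^ l) \<in> borel_measurable M"
    using assms[THEN finite_moments_measurable] by measurable
  have *: "\<bar>x * y\<bar> \<le> x\<^sup>2 + y\<^sup>2" for x y :: real
  proof -
    have "0 \<le> (\<bar>x\<bar> - \<bar>y\<bar>)\<^sup>2" by simp
    then have "2 * \<bar>x * y\<bar> \<le> x\<^sup>2 + y\<^sup>2" by (simp add: power2_diff abs_mult)
    moreover have "0 \<le> \<bar>x * y\<bar>" by simp
    ultimately show ?thesis by linarith
  qed
  have "norm (F \<omega> ^ k * G \<omega> ^ l) \<le> norm (F \<omega> ^ (2 * k) + G \<omega> ^ (2 * l))" for \<omega>
  proof -
    have "norm (F \<omega> ^ k * G \<omega> ^ l) \<le> (F \<omega> ^ k)\<^sup>2 + (G \<omega> ^ l)\<^sup>2" using * by simp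
    also have "\<dots> = F \<omega> ^ (2 * k) + G \<omega> ^ (2 * l)" by (simp add: mult.commute flip: power_mult)
    also have "\<dots> \<le> norm (F \<omega> ^ (2 * k) + G \<omega> ^ (2 * l))" by simp
    finally show ?thesis .
  qed
  then show "AE \<omega> in M. norm (F \<omega> ^ k * G \<omega> ^ l) \<le> norm (F \<omega> ^ (2 * k) + G \<omega> ^ (2 * l))"
    by simp
qed

lemma finite_moments_mult:
  assumes "finite_moments M F" "finite_moments M G"
  shows "finite_moments M (\<lambda>\<omega>. F \<omega> * G \<omega>)"
  using assms finite_moments_integrable_mono[OF assms]
  by (auto simp: finite_moments_def power_mult_distrib)

lemma finite_moments_add:
  assumes "finite_moments M F" "finite_moments M G"
  shows "finite_moments M (\<lambda>\<omega>. F \<omega> + G \<omega>)"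
  unfolding finite_moments_def
proof (intro conjI allI)
  show "(\<lambda>\<omega>. F \<omega> + G \<omega>) \<in> borel_measurable M"
    using assms[THEN finite_moments_measurable] by measurable
  fix n
  have "integrable M (\<lambda>\<omega>. \<Sum>k\<le>n. real (n choose k) * (F \<omega> ^ k * G \<omega> ^ (n - k)))"
    by (intro Bochner_Integration.integrable_sum integrable_mult_right finite_moments_integrable_mono assms)
  then show "integrable M (\<lambda>\<omega>. (F \<omega> + G \<omega>) ^ n)"
    by (simp add: binomial_ring mult.assoc)
qed

lemma (in prob_space) finite_moments_const: "finite_moments M (\<lambda>_. c)"
  by (simp add: finite_moments_def)

lemma (in prob_space) finite_moments_sum:
  "(\<And>i. i \<in> A \<Longrightarrow> finite_moments M (F i)) \<Longrightarrow> finite_moments M (\<lambda>\<omega>. \<Sum>i\<in>A. F i \<omega>)"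
  by (induction A rule: infinite_finite_induct)
     (simp_all add: finite_moments_const finite_moments_add)

lemma (in prob_space) finite_moments_diff_const:
  assumes "finite_moments M F" shows "finite_moments M (\<lambda>\<omega>. F \<omega> - c)"
  using finite_moments_add[OF assms finite_moments_const[of "- c"]] by simp

section \<open>Gaussian integration by parts\<close>

text \<open>On the diagonal \<open>e = prod.swap e\<close>, so both indicators fire and the variance
  is c (1 + \<gamma>), as the elliptic law prescribes; no separate diagonal case arises.\<close>

definition elliptic_cov :: "real \<Rightarrow> real \<Rightarrow> nat \<times> nat \<Rightarrow> nat \<times> nat \<Rightarrow> real" where
  "elliptic_cov \<gamma> c e e' = c * (of_bool (e = e') + \<gamma> * of_bool (e = prod.swap e'))"

primrec monom_rv :: "(nat \<times> nat \<Rightarrow> 'a \<Rightarrow> real) \<Rightarrow> (nat \<times> nat) list \<Rightarrow> 'a \<Rightarrow> real" where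
  "monom_rv y [] = (\<lambda>\<omega>. 1)"
| "monom_rv y (e' # es) = (\<lambda>\<omega>. y e' \<omega> * monom_rv y es \<omega>)"

text \<open>The derivation that sends the variable at \<open>e'\<close> to \<open>d e'\<close>. With
  \<open>d = elliptic_cov \<gamma> c e\<close> it is the sum over all contractions of a factor at
  \<open>e\<close> with a factor of the monomial.\<close>

primrec dmonom_rv :: "(nat \<times> nat \<Rightarrow> real) \<Rightarrow> (nat \<times> nat \<Rightarrow> 'a \<Rightarrow> real) \<Rightarrow> (nat \<times> nat) list \<Rightarrow> 'a \<Rightarrow> real" where
  "dmonom_rv d y [] = (\<lambda>\<omega>. 0)"
| "dmonom_rv d y (e' # es) = (\<lambda>\<omega>. d e' * monom_rv y es \<omega> + y e' \<omega> * dmonom_rv d y es \<omega>)"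

lemma monom_rv_append: "monom_rv y (es @ es') \<omega> = monom_rv y es \<omega> * monom_rv y es' \<omega>"
  by (induction es) (simp_all add: mult.assoc)

lemma dmonom_rv_append:
  "dmonom_rv d y (es @ es') \<omega> = dmonom_rv d y es \<omega> * monom_rv y es' \<omega> + monom_rv y es \<omega> * dmonom_rv d y es' \<omega>"
  by (induction es) (simp_all add: monom_rv_append algebra_simps)

text \<open>
  A word is a list of booleans, where \<open>True\<close> stands for \<open>X\<close> and \<open>False\<close> for the transpose of \<open>X\<close>.
  Pairing an occurrence of \<open>x\<close> at \<open>(a, b)\<close> with an occurrence of \<open>z\<close> at \<open>(i, k)\<close> identifies
  the indices either as \<open>i = b, k = a\<close> (an orientable, straight pairing) or as
  \<open>i = a, k = b\<close> (a twisted one).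
\<close>

definition straight_wt :: "real \<Rightarrow> bool \<Rightarrow> bool \<Rightarrow> real" where
  "straight_wt \<gamma> x z = (if x = z then \<gamma> else 1)"

definition twisted_wt :: "real \<Rightarrow> bool \<Rightarrow> bool \<Rightarrow> real" where
  "twisted_wt \<gamma> x z = (if x = z then 1 else \<gamma>)"

definition letter_pos :: "bool \<Rightarrow> nat \<Rightarrow> nat \<Rightarrow> nat \<times> nat" where
  "letter_pos b i k = (if b then (i, k) else (k, i))"

text \<open>Equal letters at equal positions read the same variable (weight 1), at reversed
  positions the opposite one (weight \<gamma>); for distinct letters the transpose exchanges the two
  cases. If \<open>a = b\<close> both terms can apply, which accounts for the diagonal
  variance.\<close>

lemma elliptic_cov_letter_pos:
  "elliptic_cov \<gamma> c (letter_pos x a b) (letter_pos z i k) =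
     c * (twisted_wt \<gamma> x z * of_bool (i = a \<and> k = b) + straight_wt \<gamma> x z * of_bool (i = b \<and> k = a))"
  unfolding elliptic_cov_def letter_pos_def twisted_wt_def straight_wt_def
  by (cases x; cases z; cases "i = a"; cases "k = b"; cases "i = b"; cases "k = a") simp_all

definition word_transpose :: "bool list \<Rightarrow> bool list" where
  "word_transpose w = map Not (rev w)"

definition skip_nth :: "nat \<Rightarrow> 'b list \<Rightarrow> 'b list" where
  "skip_nth j vs = take j vs @ drop (Suc j) vs"

definition cut_at :: "nat \<Rightarrow> 'b list \<Rightarrow> 'b list" where
  "cut_at l v = drop (Suc l) v @ take l v"

lemma sum_swap3: "(\<Sum>a\<in>A. \<Sum>b\<in>B. \<Sum>l\<in>L. f a b l) = (\<Sum>l\<in>L. \<Sum>a\<in>A. \<Sum>b\<in>B. f a b l)"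
proof -
  have "(\<Sum>a\<in>A. \<Sum>b\<in>B. \<Sum>l\<in>L. f a b l) = (\<Sum>a\<in>A. \<Sum>l\<in>L. \<Sum>b\<in>B. f a b l)"
    by (intro sum.cong refl sum.swap)
  also have "\<dots> = (\<Sum>l\<in>L. \<Sum>a\<in>A. \<Sum>b\<in>B. f a b l)" by (rule sum.swap)
  finally show ?thesis .
qed

lemma sum_two_products:
  "(\<Sum>i\<in>A. r * (s * (f i * g i) + t * (f' i * g' i)))
     = r * (s * (\<Sum>i\<in>A. g i * f i) + t * (\<Sum>i\<in>A. g' i * f' i))" for r s t :: real
  by (simp only: sum_distrib_left sum.distrib distrib_left mult_ac)

text \<open>Everything about traces follows from Wick's formula for monomials in the entries;
  Gaussian laws and independence enter only when the locale is instantiated. The scale 1/N is the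
  normalization of the matrix.\<close>

locale gaussian_words = prob_space M for M :: "'a measure" +
  fixes \<gamma> :: real and N :: nat and y :: "nat \<times> nat \<Rightarrow> 'a \<Rightarrow> real"
  assumes N_pos: "N \<ge> 1"
    and entry_moments: "e \<in> {..<N} \<times> {..<N} \<Longrightarrow> finite_moments M (y e)"
    and wick: "e \<in> {..<N} \<times> {..<N} \<Longrightarrow> set es \<subseteq> {..<N} \<times> {..<N} \<Longrightarrow>
      expectation (\<lambda>\<omega>. y e \<omega> * monom_rv y es \<omega>)
      = expectation (dmonom_rv (elliptic_cov \<gamma> (1 / real N) e) y es)"
begin

text \<open>A relation and not an operator: its arguments are functions of \<omega>, and different
  polynomials in the entries can define the same function. Products are not among the rules, so a
  property linear in the pair has to be checked on monomials only.\<close>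

inductive has_d :: "(nat \<times> nat) \<Rightarrow> ('a \<Rightarrow> real) \<Rightarrow> ('a \<Rightarrow> real) \<Rightarrow> bool" for e where
  monom: "set es \<subseteq> {..<N} \<times> {..<N} \<Longrightarrow>
    has_d e (monom_rv y es) (dmonom_rv (elliptic_cov \<gamma> (1 / real N) e) y es)"
| add: "has_d e F F' \<Longrightarrow> has_d e G G' \<Longrightarrow> has_d e (\<lambda>\<omega>. F \<omega> + G \<omega>) (\<lambda>\<omega>. F' \<omega> + G' \<omega>)"
| scale: "has_d e F F' \<Longrightarrow> has_d e (\<lambda>\<omega>. r * F \<omega>) (\<lambda>\<omega>. r * F' \<omega>)"

lemma has_d_cong: "has_d e F F' \<Longrightarrow> (\<And>\<omega>. F \<omega> = G \<omega>) \<Longrightarrow> (\<And>\<omega>. F' \<omega> = G' \<omega>) \<Longrightarrow> has_d e G G'"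
  by (metis ext)

lemma has_d_const: "has_d e (\<lambda>_. r) (\<lambda>_. 0)"
  using scale[OF monom[of "[]"], of e r] by simp

lemma has_d_entry:
  "e' \<in> {..<N} \<times> {..<N} \<Longrightarrow> has_d e (y e') (\<lambda>_. elliptic_cov \<gamma> (1 / real N) e e')"
  using monom[of "[e']" e] by simp

lemma has_d_sum:
  "finite A \<Longrightarrow> (\<And>i. i \<in> A \<Longrightarrow> has_d e (F i) (F' i))
    \<Longrightarrow> has_d e (\<lambda>\<omega>. \<Sum>i\<in>A. F i \<omega>) (\<lambda>\<omega>. \<Sum>i\<in>A. F' i \<omega>)"
  by (induction A rule: finite_induct) (simp_all add: has_d_const add)

text \<open>Both sides are bilinear in the two pairs, so a nested induction leaves two monomials,
  whose product is the concatenation of their lists.\<close>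

lemma has_d_mult:
  assumes "has_d e F F'" "has_d e G G'"
  shows "has_d e (\<lambda>\<omega>. F \<omega> * G \<omega>) (\<lambda>\<omega>. F' \<omega> * G \<omega> + F \<omega> * G' \<omega>)"
  using assms(1)
proof induction
  case (monom es)
  show ?case
    using assms(2)
  proof induction
    case m: (monom es')
    show ?case
      by (rule has_d_cong[OF has_d.monom[of "es @ es'"]])
         (use monom m in \<open>auto simp: monom_rv_append dmonom_rv_append\<close>)
  next
    case (add F F' G G')
    show ?case
      by (rule has_d_cong[OF has_d.add[OF add.IH]]) (auto simp: algebra_simps)
  next
    case (scale G G' r)
    show ?case
      by (rule has_d_cong[OF has_d.scale[OF scale.IH, of r]]) (auto simp: algebra_simps)
  qed
next
  case (add F F' G G')
  show ?case
    by (rule has_d_cong[OF has_d.add[OF add.IH]]) (auto simp: algebra_simps)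
next
  case (scale G G' r)
  show ?case
    by (rule has_d_cong[OF has_d.scale[OF scale.IH, of r]]) (auto simp: algebra_simps)
qed

lemma monom_rv_moments: "set es \<subseteq> {..<N} \<times> {..<N} \<Longrightarrow> finite_moments M (monom_rv y es)"
  by (induction es) (auto intro!: finite_moments_const finite_moments_mult entry_moments)

lemma dmonom_rv_moments: "set es \<subseteq> {..<N} \<times> {..<N} \<Longrightarrow> finite_moments M (dmonom_rv d y es)"
  by (induction es)
     (auto intro!: finite_moments_const finite_moments_add finite_moments_mult entry_moments monom_rv_moments)

lemma has_d_moments: "has_d e F F' \<Longrightarrow> finite_moments M F \<and> finite_moments M F'"
  by (induction rule: has_d.induct)
     (auto intro!: monom_rv_moments dmonom_rv_moments finite_moments_add finite_moments_mult finite_moments_const)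

lemma integration_by_parts:
  assumes "has_d e F F'" "e \<in> {..<N} \<times> {..<N}"
  shows "expectation (\<lambda>\<omega>. y e \<omega> * F \<omega>) = expectation F'"
  using assms(1)
proof induction
  case (monom es)
  then show ?case using wick assms(2) by simp
next
  case (add F F' G G')
  note int = add.hyps[THEN has_d_moments]
  have "integrable M (\<lambda>\<omega>. y e \<omega> * F \<omega>)" "integrable M (\<lambda>\<omega>. y e \<omega> * G \<omega>)"
    using int entry_moments[OF assms(2)] by (auto intro!: finite_moments_integrable finite_moments_mult)
  moreover have "integrable M F'" "integrable M G'"
    using int by (auto intro!: finite_moments_integrable)
  ultimately show ?case using add.IH by (simp add: distrib_left)
next
  case (scale F F' r)
  then show ?case by (simp add: mult.left_commute)
qed

section \<open>Traces of words\<close>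

text \<open>Matrix products written out as index sums, away from the type \<open>mat\<close> and its
  dimension conditions; \<open>mat_word_entry\<close> connects the two.\<close>

primrec word_entry :: "bool list \<Rightarrow> nat \<Rightarrow> nat \<Rightarrow> 'a \<Rightarrow> real" where
  "word_entry [] i j = (\<lambda>\<omega>. of_bool (i = j))"
| "word_entry (b # w) i j = (\<lambda>\<omega>. \<Sum>k<N. y (letter_pos b i k) \<omega> * word_entry w k j \<omega>)"

definition word_trace :: "bool list \<Rightarrow> 'a \<Rightarrow> real" where
  "word_trace w = (\<lambda>\<omega>. \<Sum>i<N. word_entry w i i \<omega>)"

lemma letter_pos_mem: "i < N \<Longrightarrow> k < N \<Longrightarrow> letter_pos b i k \<in> {..<N} \<times> {..<N}"
  by (simp add: letter_pos_def)

lemma sum_of_bool_eq: "i < N \<Longrightarrow> (\<Sum>k<N. of_bool (i = k) * f k) = (f i :: real)"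
  "i < N \<Longrightarrow> (\<Sum>k<N. of_bool (k = i) * f k) = (f i :: real)"
  by (simp_all add: of_bool_def if_distrib[of "\<lambda>x. x * _"] sum.delta sum.delta' cong: if_cong)

lemma word_entry_append:
  "i < N \<Longrightarrow> word_entry (u @ v) i j \<omega> = (\<Sum>k<N. word_entry u i k \<omega> * word_entry v k j \<omega>)"
proof (induction u arbitrary: i)
  case Nil
  then show ?case by (simp add: sum_of_bool_eq)
next
  case (Cons b u)
  have "word_entry ((b # u) @ v) i j \<omega>
      = (\<Sum>l<N. \<Sum>k<N. y (letter_pos b i l) \<omega> * (word_entry u l k \<omega> * word_entry v k j \<omega>))"
    using Cons.IH by (simp add: sum_distrib_left)
  also have "\<dots> = (\<Sum>k<N. \<Sum>l<N. y (letter_pos b i l) \<omega> * (word_entry u l k \<omega> * word_entry v k j \<omega>))"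
    by (rule sum.swap)
  finally show ?case by (simp add: sum_distrib_right mult.assoc)
qed

lemma word_entry_snoc:
  assumes "i < N" "j < N"
  shows "word_entry (u @ [b]) i j \<omega> = (\<Sum>k<N. word_entry u i k \<omega> * y (letter_pos b k j) \<omega>)"
proof -
  have "word_entry [b] k j \<omega> = y (letter_pos b k j) \<omega>" for k
    using sum_of_bool_eq(2)[OF assms(2), of "\<lambda>l. y (letter_pos b k l) \<omega>"] by (simp add: mult.commute)
  then show ?thesis by (simp only: word_entry_append[OF assms(1)])
qed

lemma word_entry_transpose:
  "i < N \<Longrightarrow> j < N \<Longrightarrow> word_entry (word_transpose w) i j \<omega> = word_entry w j i \<omega>"
proof (induction w arbitrary: i j)
  case Nil
  then show ?case by (auto simp: word_transpose_def)
next
  case (Cons b w)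
  have "letter_pos (\<not> b) k j = letter_pos b j k" for k by (simp add: letter_pos_def)
  moreover have "word_transpose (b # w) = word_transpose w @ [\<not> b]" by (simp add: word_transpose_def)
  ultimately show ?case
    using Cons by (simp add: word_entry_snoc mult.commute)
qed

lemma word_trace_rotate: "word_trace (u @ v) = word_trace (v @ u)"
proof
  fix \<omega>
  have "word_trace (u @ v) \<omega> = (\<Sum>i<N. \<Sum>k<N. word_entry u i k \<omega> * word_entry v k i \<omega>)"
    by (simp add: word_trace_def word_entry_append)
  also have "\<dots> = (\<Sum>k<N. \<Sum>i<N. word_entry u i k \<omega> * word_entry v k i \<omega>)" by (rule sum.swap)
  finally show "word_trace (u @ v) \<omega> = word_trace (v @ u) \<omega>"
    by (simp add: word_trace_def word_entry_append mult.commute)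
qed

text \<open>The product rule gives one summand per letter \<open>l\<close>; contracting that letter
  cuts the index chain from \<open>i\<close> to \<open>j\<close> there. A twisted pairing keeps the
  order of the new ends \<open>a\<close>, \<open>b\<close>, a straight one reverses it.\<close>

lemma has_d_word_entry:
  assumes "a < N" "b < N" "i < N" "j < N"
  shows "has_d (letter_pos x a b) (word_entry w i j) (\<lambda>\<omega>. \<Sum>l<length w. (1 / real N) *
     (twisted_wt \<gamma> x (w ! l) * (word_entry (take l w) i a \<omega> * word_entry (drop (Suc l) w) b j \<omega>)
    + straight_wt \<gamma> x (w ! l) * (word_entry (take l w) i b \<omega> * word_entry (drop (Suc l) w) a j \<omega>)))"
  using assms(3)
proof (induction w arbitrary: i)
  case Nil
  then show ?case by (simp add: has_d_const)
next
  case (Cons z w)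
  let ?e = "letter_pos x a b" and ?c = "1 / real N"
  let ?g = "\<lambda>w i l \<omega>. ?c *
     (twisted_wt \<gamma> x (w ! l) * (word_entry (take l w) i a \<omega> * word_entry (drop (Suc l) w) b j \<omega>)
    + straight_wt \<gamma> x (w ! l) * (word_entry (take l w) i b \<omega> * word_entry (drop (Suc l) w) a j \<omega>))"
  have d: "has_d ?e (\<lambda>\<omega>. \<Sum>k<N. y (letter_pos z i k) \<omega> * word_entry w k j \<omega>)
     (\<lambda>\<omega>. \<Sum>k<N. elliptic_cov \<gamma> ?c ?e (letter_pos z i k) * word_entry w k j \<omega>
        + y (letter_pos z i k) \<omega> * (\<Sum>l<length w. ?g w k l \<omega>))"
    by (intro has_d_sum has_d_mult has_d_entry letter_pos_mem Cons) (use Cons in auto)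
  show ?case
  proof (rule has_d_cong[OF d])
    fix \<omega>
    \<comment> \<open>The derivative falls on the first letter: the Kronecker deltas collapse the
      sum over \<open>k\<close> and give summand 0. Then \<open>B\<close> collects the tail as the
      shifted summands.\<close>
    have A: "(\<Sum>k<N. elliptic_cov \<gamma> ?c ?e (letter_pos z i k) * word_entry w k j \<omega>) = ?g (z # w) i 0 \<omega>"
    proof -
      have "elliptic_cov \<gamma> ?c ?e (letter_pos z i k) * word_entry w k j \<omega>
         = ?c * twisted_wt \<gamma> x z * of_bool (i = a) * (of_bool (k = b) * word_entry w k j \<omega>)
         + ?c * straight_wt \<gamma> x z * of_bool (i = b) * (of_bool (k = a) * word_entry w k j \<omega>)" for k
        unfolding elliptic_cov_letter_pos of_bool_conj by (simp only: distrib_left distrib_right mult_ac)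
      then have "(\<Sum>k<N. elliptic_cov \<gamma> ?c ?e (letter_pos z i k) * word_entry w k j \<omega>)
         = ?c * twisted_wt \<gamma> x z * of_bool (i = a) * (\<Sum>k<N. of_bool (k = b) * word_entry w k j \<omega>)
         + ?c * straight_wt \<gamma> x z * of_bool (i = b) * (\<Sum>k<N. of_bool (k = a) * word_entry w k j \<omega>)"
        by (simp only: sum.distrib sum_distrib_left)
      then show ?thesis
        unfolding sum_of_bool_eq(2)[OF assms(1)] sum_of_bool_eq(2)[OF assms(2)]
        by (simp only: take_0 drop_Suc_Cons drop_0 nth_Cons_0 word_entry.simps distrib_left mult_ac)
    qed
    have B: "(\<Sum>k<N. y (letter_pos z i k) \<omega> * (\<Sum>l<length w. ?g w k l \<omega>)) = (\<Sum>l<length w. ?g (z # w) i (Suc l) \<omega>)"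
    proof -
      have "(\<Sum>k<N. y (letter_pos z i k) \<omega> * (\<Sum>l<length w. ?g w k l \<omega>))
        = (\<Sum>l<length w. \<Sum>k<N. y (letter_pos z i k) \<omega> * ?g w k l \<omega>)"
        unfolding sum_distrib_left by (rule sum.swap)
      also have "\<dots> = (\<Sum>l<length w. ?g (z # w) i (Suc l) \<omega>)"
      proof (rule sum.cong[OF refl])
        fix l
        have "(\<Sum>k<N. y (letter_pos z i k) \<omega> * ?g w k l \<omega>) = ?c *
          (twisted_wt \<gamma> x (w ! l) * ((\<Sum>k<N. y (letter_pos z i k) \<omega> * word_entry (take l w) k a \<omega>) * word_entry (drop (Suc l) w) b j \<omega>)
         + straight_wt \<gamma> x (w ! l) * ((\<Sum>k<N. y (letter_pos z i k) \<omega> * word_entry (take l w) k b \<omega>) * word_entry (drop (Suc l) w) a j \<omega>))"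
          by (simp only: sum_distrib_left sum_distrib_right sum.distrib distrib_left mult_ac)
        then show "(\<Sum>k<N. y (letter_pos z i k) \<omega> * ?g w k l \<omega>) = ?g (z # w) i (Suc l) \<omega>" by simp
      qed
      finally show ?thesis .
    qed
    show "(\<Sum>k<N. elliptic_cov \<gamma> ?c ?e (letter_pos z i k) * word_entry w k j \<omega>
        + y (letter_pos z i k) \<omega> * (\<Sum>l<length w. ?g w k l \<omega>)) = (\<Sum>l<length (z # w). ?g (z # w) i l \<omega>)"
      unfolding sum.distrib A B length_Cons by (simp only: sum.lessThan_Suc_shift)
  qed simp
qed

definition word_trace_d :: "bool \<Rightarrow> nat \<Rightarrow> nat \<Rightarrow> bool list \<Rightarrow> 'a \<Rightarrow> real" where
  "word_trace_d x a b v = (\<lambda>\<omega>. \<Sum>l<length v. (1 / real N) *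
     (twisted_wt \<gamma> x (v ! l) * word_entry (drop (Suc l) v @ take l v) b a \<omega>
    + straight_wt \<gamma> x (v ! l) * word_entry (drop (Suc l) v @ take l v) a b \<omega>))"

text \<open>Summing over the diagonal index glues the end of the word to its start, so the two
  pieces around letter \<open>l\<close> become one entry of the circle opened at
  \<open>l\<close>.\<close>

lemma has_d_word_trace:
  assumes "a < N" "b < N"
  shows "has_d (letter_pos x a b) (word_trace v) (word_trace_d x a b v)"
proof -
  let ?c = "1 / real N"
  have d: "has_d (letter_pos x a b) (\<lambda>\<omega>. \<Sum>i<N. word_entry v i i \<omega>) (\<lambda>\<omega>. \<Sum>i<N. \<Sum>l<length v. ?c *
     (twisted_wt \<gamma> x (v ! l) * (word_entry (take l v) i a \<omega> * word_entry (drop (Suc l) v) b i \<omega>)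
    + straight_wt \<gamma> x (v ! l) * (word_entry (take l v) i b \<omega> * word_entry (drop (Suc l) v) a i \<omega>)))"
    by (intro has_d_sum has_d_word_entry assms) auto
  show ?thesis
  proof (rule has_d_cong[OF d])
    fix \<omega>
    show "(\<Sum>i<N. \<Sum>l<length v. ?c *
     (twisted_wt \<gamma> x (v ! l) * (word_entry (take l v) i a \<omega> * word_entry (drop (Suc l) v) b i \<omega>)
    + straight_wt \<gamma> x (v ! l) * (word_entry (take l v) i b \<omega> * word_entry (drop (Suc l) v) a i \<omega>)))
      = word_trace_d x a b v \<omega>"
      unfolding word_trace_d_def word_entry_append[OF assms(1)] word_entry_append[OF assms(2)]
      by (subst sum.swap) (simp only: sum_two_products)
  qed (simp add: word_trace_def)
qed

lemma word_trace_moments: "finite_moments M (word_trace v)"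
  using has_d_moments[OF has_d_word_trace[of 0 0]] N_pos by auto

lemma word_entry_moments: "i < N \<Longrightarrow> j < N \<Longrightarrow> finite_moments M (word_entry v i j)"
  using has_d_moments[OF has_d_word_entry[of 0 0 i j]] N_pos by auto

lemma word_trace_Cons:
  "word_trace (x # w) \<omega> = (\<Sum>a<N. \<Sum>b<N. y (letter_pos x a b) \<omega> * word_entry w b a \<omega>)"
  by (simp add: word_trace_def)

lemma sum_word_entry_mult: "(\<Sum>a<N. \<Sum>b<N. word_entry u a b \<omega> * word_entry v b a \<omega>) = word_trace (u @ v) \<omega>"
  by (simp add: word_trace_def word_entry_append)

lemma expectation_sum2:
  assumes "\<And>a b. a < N \<Longrightarrow> b < N \<Longrightarrow> finite_moments M (F a b)"
  shows "expectation (\<lambda>\<omega>. \<Sum>a<N. \<Sum>b<N. F a b \<omega>) = (\<Sum>a<N. \<Sum>b<N. expectation (F a b))"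
proof -
  have "integrable M (F a b)" if "a < N" "b < N" for a b
    using assms that finite_moments_integrable by blast
  then show ?thesis
    by (subst Bochner_Integration.integral_sum) (auto intro!: sum.cong)
qed

text \<open>The Schwinger--Dyson equation: integrate by parts with respect to the first letter.\<close>

lemma schwinger_dyson:
  assumes R: "\<And>a b. a < N \<Longrightarrow> b < N \<Longrightarrow> has_d (letter_pos x a b) R (R' a b)"
  shows "expectation (\<lambda>\<omega>. word_trace (x # w) \<omega> * R \<omega>) =
    (\<Sum>l<length w. (1 / real N) *
      (straight_wt \<gamma> x (w ! l) * expectation (\<lambda>\<omega>. word_trace (take l w) \<omega> * word_trace (drop (Suc l) w) \<omega> * R \<omega>)
     + twisted_wt \<gamma> x (w ! l) * expectation (\<lambda>\<omega>. word_trace (word_transpose (take l w) @ drop (Suc l) w) \<omega> * R \<omega>)))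
    + expectation (\<lambda>\<omega>. \<Sum>a<N. \<Sum>b<N. word_entry w b a \<omega> * R' a b \<omega>)"
proof -
  let ?c = "1 / real N"
  let ?D = "\<lambda>a b \<omega>. \<Sum>l<length w. ?c *
     (twisted_wt \<gamma> x (w ! l) * (word_entry (take l w) b a \<omega> * word_entry (drop (Suc l) w) b a \<omega>)
    + straight_wt \<gamma> x (w ! l) * (word_entry (take l w) b b \<omega> * word_entry (drop (Suc l) w) a a \<omega>))"
  have Rm: "finite_moments M R" using has_d_moments[OF R[of 0 0]] N_pos by auto
  have R'm: "finite_moments M (R' a b)" if "a < N" "b < N" for a b
    using R[OF that] has_d_moments by blast
  note fm = finite_moments_sum finite_moments_mult finite_moments_add finite_moments_const
    word_entry_moments word_trace_moments entry_moments letter_pos_mem Rm R'm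
  have Dm: "finite_moments M (?D a b)" if "a < N" "b < N" for a b
    by (intro fm) (use that in auto)
  have "expectation (\<lambda>\<omega>. word_trace (x # w) \<omega> * R \<omega>)
     = expectation (\<lambda>\<omega>. \<Sum>a<N. \<Sum>b<N. y (letter_pos x a b) \<omega> * (word_entry w b a \<omega> * R \<omega>))"
    by (simp add: word_trace_Cons sum_distrib_right mult.assoc)
  also have "\<dots> = (\<Sum>a<N. \<Sum>b<N. expectation (\<lambda>\<omega>. y (letter_pos x a b) \<omega> * (word_entry w b a \<omega> * R \<omega>)))"
    by (intro expectation_sum2 fm) auto
  also have "\<dots> = (\<Sum>a<N. \<Sum>b<N. expectation (\<lambda>\<omega>. ?D a b \<omega> * R \<omega> + word_entry w b a \<omega> * R' a b \<omega>))"
    by (intro sum.cong refl integration_by_parts has_d_mult has_d_word_entry R letter_pos_mem) auto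
  also have "\<dots> = expectation (\<lambda>\<omega>. \<Sum>a<N. \<Sum>b<N. ?D a b \<omega> * R \<omega> + word_entry w b a \<omega> * R' a b \<omega>)"
    by (intro expectation_sum2[symmetric] fm) auto
  also have "\<dots> = expectation (\<lambda>\<omega>. (\<Sum>a<N. \<Sum>b<N. ?D a b \<omega>) * R \<omega> + (\<Sum>a<N. \<Sum>b<N. word_entry w b a \<omega> * R' a b \<omega>))"
    by (simp add: sum.distrib sum_distrib_right)
  also have "(\<lambda>\<omega>. \<Sum>a<N. \<Sum>b<N. ?D a b \<omega>) = (\<lambda>\<omega>. \<Sum>l<length w. ?c *
     (straight_wt \<gamma> x (w ! l) * (word_trace (take l w) \<omega> * word_trace (drop (Suc l) w) \<omega>)
    + twisted_wt \<gamma> x (w ! l) * word_trace (word_transpose (take l w) @ drop (Suc l) w) \<omega>))"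
  proof
    fix \<omega>
    have "(\<Sum>a<N. \<Sum>b<N. ?D a b \<omega>) = (\<Sum>l<length w. \<Sum>a<N. \<Sum>b<N. ?c *
     (twisted_wt \<gamma> x (w ! l) * (word_entry (take l w) b a \<omega> * word_entry (drop (Suc l) w) b a \<omega>)
    + straight_wt \<gamma> x (w ! l) * (word_entry (take l w) b b \<omega> * word_entry (drop (Suc l) w) a a \<omega>)))"
      by (rule sum_swap3)
    also have "\<dots> = (\<Sum>l<length w. ?c *
     (twisted_wt \<gamma> x (w ! l) * (\<Sum>a<N. \<Sum>b<N. word_entry (take l w) b a \<omega> * word_entry (drop (Suc l) w) b a \<omega>)
    + straight_wt \<gamma> x (w ! l) * (\<Sum>a<N. \<Sum>b<N. word_entry (take l w) b b \<omega> * word_entry (drop (Suc l) w) a a \<omega>)))"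
      by (simp only: sum.distrib sum_distrib_left distrib_left)
    also have "\<dots> = (\<Sum>l<length w. ?c *
     (straight_wt \<gamma> x (w ! l) * (word_trace (take l w) \<omega> * word_trace (drop (Suc l) w) \<omega>)
    + twisted_wt \<gamma> x (w ! l) * word_trace (word_transpose (take l w) @ drop (Suc l) w) \<omega>))"
    proof (intro sum.cong refl arg_cong2[of _ _ _ _ "(*)"])
      fix l
      \<comment> \<open>In the twisted case both pieces run from \<open>b\<close> to
        \<open>a\<close>, and transposing one of them closes the chain to a single trace. In the
        straight case each piece is already closed and the sum factorizes into two traces.\<close>
      have "(\<Sum>a<N. \<Sum>b<N. word_entry (take l w) b a \<omega> * word_entry (drop (Suc l) w) b a \<omega>)
        = (\<Sum>a<N. \<Sum>b<N. word_entry (word_transpose (take l w)) a b \<omega> * word_entry (drop (Suc l) w) b a \<omega>)"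
        by (simp add: word_entry_transpose)
      moreover have "(\<Sum>a<N. \<Sum>b<N. word_entry (take l w) b b \<omega> * word_entry (drop (Suc l) w) a a \<omega>)
        = word_trace (take l w) \<omega> * word_trace (drop (Suc l) w) \<omega>"
        unfolding word_trace_def sum_product by (rule sum.swap)
      ultimately show "twisted_wt \<gamma> x (w ! l) * (\<Sum>a<N. \<Sum>b<N. word_entry (take l w) b a \<omega> * word_entry (drop (Suc l) w) b a \<omega>)
    + straight_wt \<gamma> x (w ! l) * (\<Sum>a<N. \<Sum>b<N. word_entry (take l w) b b \<omega> * word_entry (drop (Suc l) w) a a \<omega>)
      = straight_wt \<gamma> x (w ! l) * (word_trace (take l w) \<omega> * word_trace (drop (Suc l) w) \<omega>)
    + twisted_wt \<gamma> x (w ! l) * word_trace (word_transpose (take l w) @ drop (Suc l) w) \<omega>"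
        by (simp add: sum_word_entry_mult)
    qed
    finally show "(\<Sum>a<N. \<Sum>b<N. ?D a b \<omega>) = \<dots>" .
  qed
  also have "expectation (\<lambda>\<omega>. (\<Sum>l<length w. ?c *
     (straight_wt \<gamma> x (w ! l) * (word_trace (take l w) \<omega> * word_trace (drop (Suc l) w) \<omega>)
    + twisted_wt \<gamma> x (w ! l) * word_trace (word_transpose (take l w) @ drop (Suc l) w) \<omega>)) * R \<omega>
    + (\<Sum>a<N. \<Sum>b<N. word_entry w b a \<omega> * R' a b \<omega>))
   = expectation (\<lambda>\<omega>. (\<Sum>l<length w. ?c *
     (straight_wt \<gamma> x (w ! l) * (word_trace (take l w) \<omega> * word_trace (drop (Suc l) w) \<omega> * R \<omega>)
    + twisted_wt \<gamma> x (w ! l) * (word_trace (word_transpose (take l w) @ drop (Suc l) w) \<omega> * R \<omega>)))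
    + (\<Sum>a<N. \<Sum>b<N. word_entry w b a \<omega> * R' a b \<omega>))"
    by (simp only: sum_distrib_right distrib_right mult.assoc)
  also have "\<dots> = expectation (\<lambda>\<omega>. \<Sum>l<length w. ?c *
     (straight_wt \<gamma> x (w ! l) * (word_trace (take l w) \<omega> * word_trace (drop (Suc l) w) \<omega> * R \<omega>)
    + twisted_wt \<gamma> x (w ! l) * (word_trace (word_transpose (take l w) @ drop (Suc l) w) \<omega> * R \<omega>)))
    + expectation (\<lambda>\<omega>. \<Sum>a<N. \<Sum>b<N. word_entry w b a \<omega> * R' a b \<omega>)"
    by (intro Bochner_Integration.integral_add finite_moments_integrable fm) auto
  also have "expectation (\<lambda>\<omega>. \<Sum>l<length w. ?c *
     (straight_wt \<gamma> x (w ! l) * (word_trace (take l w) \<omega> * word_trace (drop (Suc l) w) \<omega> * R \<omega>)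
    + twisted_wt \<gamma> x (w ! l) * (word_trace (word_transpose (take l w) @ drop (Suc l) w) \<omega> * R \<omega>)))
    = (\<Sum>l<length w. expectation (\<lambda>\<omega>. ?c *
     (straight_wt \<gamma> x (w ! l) * (word_trace (take l w) \<omega> * word_trace (drop (Suc l) w) \<omega> * R \<omega>)
    + twisted_wt \<gamma> x (w ! l) * (word_trace (word_transpose (take l w) @ drop (Suc l) w) \<omega> * R \<omega>))))"
    by (intro Bochner_Integration.integral_sum finite_moments_integrable fm)
  also have "\<dots> = (\<Sum>l<length w. ?c *
      (straight_wt \<gamma> x (w ! l) * expectation (\<lambda>\<omega>. word_trace (take l w) \<omega> * word_trace (drop (Suc l) w) \<omega> * R \<omega>)
     + twisted_wt \<gamma> x (w ! l) * expectation (\<lambda>\<omega>. word_trace (word_transpose (take l w) @ drop (Suc l) w) \<omega> * R \<omega>)))"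
  proof (intro sum.cong refl)
    fix l
    have "integrable M (\<lambda>\<omega>. straight_wt \<gamma> x (w ! l) * (word_trace (take l w) \<omega> * word_trace (drop (Suc l) w) \<omega> * R \<omega>))"
      "integrable M (\<lambda>\<omega>. twisted_wt \<gamma> x (w ! l) * (word_trace (word_transpose (take l w) @ drop (Suc l) w) \<omega> * R \<omega>))"
      by (intro finite_moments_integrable fm)+
    then show "expectation (\<lambda>\<omega>. ?c *
     (straight_wt \<gamma> x (w ! l) * (word_trace (take l w) \<omega> * word_trace (drop (Suc l) w) \<omega> * R \<omega>)
    + twisted_wt \<gamma> x (w ! l) * (word_trace (word_transpose (take l w) @ drop (Suc l) w) \<omega> * R \<omega>)))
     = ?c * (straight_wt \<gamma> x (w ! l) * expectation (\<lambda>\<omega>. word_trace (take l w) \<omega> * word_trace (drop (Suc l) w) \<omega> * R \<omega>)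
     + twisted_wt \<gamma> x (w ! l) * expectation (\<lambda>\<omega>. word_trace (word_transpose (take l w) @ drop (Suc l) w) \<omega> * R \<omega>))"
      by simp
  qed
  finally show ?thesis .
qed

section \<open>Loop equations for means and for products of centred traces\<close>

primrec centred_prod :: "bool list list \<Rightarrow> 'a \<Rightarrow> real" where
  "centred_prod [] = (\<lambda>\<omega>. 1)"
| "centred_prod (v # vs) = (\<lambda>\<omega>. (word_trace v \<omega> - expectation (word_trace v)) * centred_prod vs \<omega>)"

definition centred_moment :: "bool list list \<Rightarrow> real" where
  "centred_moment vs = expectation (centred_prod vs)"

definition mean_trace :: "bool list \<Rightarrow> real" where
  "mean_trace w = expectation (word_trace w) / real N"

lemma centred_prod_moments: "finite_moments M (centred_prod vs)"
  by (induction vs)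
     (auto intro!: finite_moments_const finite_moments_mult finite_moments_diff_const word_trace_moments)

lemma has_d_centred_prod:
  assumes "a < N" "b < N"
  shows "has_d (letter_pos x a b) (centred_prod vs)
    (\<lambda>\<omega>. \<Sum>j<length vs. word_trace_d x a b (vs ! j) \<omega> * centred_prod (skip_nth j vs) \<omega>)"
proof (induction vs)
  case Nil
  then show ?case by (simp add: has_d_const)
next
  case (Cons v vs)
  let ?e = "letter_pos x a b"
  have "has_d ?e (\<lambda>\<omega>. word_trace v \<omega> - expectation (word_trace v)) (word_trace_d x a b v)"
    by (rule has_d_cong[OF add[OF has_d_word_trace[OF assms] has_d_const[of _ "- expectation (word_trace v)"]]]) auto
  note d = has_d_mult[OF this Cons.IH]
  show ?case
  proof (rule has_d_cong[OF d])
    fix \<omega>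
    show "word_trace_d x a b v \<omega> * centred_prod vs \<omega> + (word_trace v \<omega> - expectation (word_trace v)) *
        (\<Sum>j<length vs. word_trace_d x a b (vs ! j) \<omega> * centred_prod (skip_nth j vs) \<omega>)
      = (\<Sum>j<length (v # vs). word_trace_d x a b ((v # vs) ! j) \<omega> * centred_prod (skip_nth j (v # vs)) \<omega>)"
      unfolding length_Cons sum.lessThan_Suc_shift
      by (simp add: skip_nth_def sum_distrib_left mult_ac)
  qed simp
qed

lemma expectation_word_trace: "expectation (word_trace u) = real N * mean_trace u"
  using N_pos by (simp add: mean_trace_def)

lemma expectation_trace_centred:
  "expectation (\<lambda>\<omega>. word_trace u \<omega> * centred_prod vs \<omega>)
    = centred_moment (u # vs) + real N * mean_trace u * centred_moment vs"
proof -
  have "integrable M (\<lambda>\<omega>. word_trace u \<omega> * centred_prod vs \<omega>)" "integrable M (centred_prod vs)"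
    by (intro finite_moments_integrable finite_moments_mult word_trace_moments centred_prod_moments)+
  then show ?thesis
    by (simp add: centred_moment_def left_diff_distrib expectation_word_trace)
qed

text \<open>Each trace is fluctuation plus mean, the mean being N times \<open>mean_trace\<close>.
  The last term carries N^2 and is the one that has to cancel in
  \<open>centred_moment_Cons\<close>.\<close>

lemma expectation_trace_trace_centred:
  "expectation (\<lambda>\<omega>. word_trace u \<omega> * word_trace v \<omega> * centred_prod vs \<omega>)
    = centred_moment (u # v # vs) + real N * mean_trace u * centred_moment (v # vs)
      + real N * mean_trace v * centred_moment (u # vs)
      + real N * mean_trace u * (real N * mean_trace v) * centred_moment vs"
proof -
  have i: "integrable M (\<lambda>\<omega>. word_trace u \<omega> * centred_prod (v # vs) \<omega>)"
    "integrable M (\<lambda>\<omega>. word_trace u \<omega> * centred_prod vs \<omega>)"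
    by (intro finite_moments_integrable finite_moments_mult word_trace_moments centred_prod_moments)+
  have "expectation (\<lambda>\<omega>. word_trace u \<omega> * word_trace v \<omega> * centred_prod vs \<omega>)
     = expectation (\<lambda>\<omega>. word_trace u \<omega> * centred_prod (v # vs) \<omega>
         + real N * mean_trace v * (word_trace u \<omega> * centred_prod vs \<omega>))"
    by (simp add: expectation_word_trace algebra_simps)
  also have "\<dots> = expectation (\<lambda>\<omega>. word_trace u \<omega> * centred_prod (v # vs) \<omega>)
         + real N * mean_trace v * expectation (\<lambda>\<omega>. word_trace u \<omega> * centred_prod vs \<omega>)"
    using i by (simp del: centred_prod.simps)
  finally show ?thesis
    unfolding expectation_trace_centred by (simp add: algebra_simps)
qed

text \<open>The pairing merges \<open>w\<close> with the opened circle \<open>v\<close>. The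
  straight remainder runs from \<open>a\<close> to \<open>b\<close> and closes up with the entry of
  \<open>w\<close> from \<open>b\<close> to \<open>a\<close>; the twisted one runs the other way and
  has to be transposed.\<close>

lemma sum_word_entry_trace_d:
  "(\<Sum>a<N. \<Sum>b<N. word_entry w b a \<omega> * word_trace_d x a b v \<omega>) = (\<Sum>l<length v. (1 / real N) *
     (twisted_wt \<gamma> x (v ! l) * word_trace (w @ word_transpose (cut_at l v)) \<omega>
    + straight_wt \<gamma> x (v ! l) * word_trace (w @ cut_at l v) \<omega>))"
proof -
  have "(\<Sum>a<N. \<Sum>b<N. word_entry w b a \<omega> * word_trace_d x a b v \<omega>)
    = (\<Sum>l<length v. \<Sum>a<N. \<Sum>b<N. word_entry w b a \<omega> * ((1 / real N) *
     (twisted_wt \<gamma> x (v ! l) * word_entry (cut_at l v) b a \<omega>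
    + straight_wt \<gamma> x (v ! l) * word_entry (cut_at l v) a b \<omega>)))"
    unfolding word_trace_d_def sum_distrib_left cut_at_def by (rule sum_swap3)
  also have "\<dots> = (\<Sum>l<length v. (1 / real N) *
     (twisted_wt \<gamma> x (v ! l) * (\<Sum>a<N. \<Sum>b<N. word_entry w b a \<omega> * word_entry (cut_at l v) b a \<omega>)
    + straight_wt \<gamma> x (v ! l) * (\<Sum>a<N. \<Sum>b<N. word_entry w b a \<omega> * word_entry (cut_at l v) a b \<omega>)))"
    by (simp only: sum.distrib sum_distrib_left distrib_left mult_ac)
  also have "\<dots> = (\<Sum>l<length v. (1 / real N) *
     (twisted_wt \<gamma> x (v ! l) * word_trace (w @ word_transpose (cut_at l v)) \<omega>
    + straight_wt \<gamma> x (v ! l) * word_trace (w @ cut_at l v) \<omega>))"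
  proof (intro sum.cong refl)
    fix l
    have "(\<Sum>a<N. \<Sum>b<N. word_entry w b a \<omega> * word_entry (cut_at l v) b a \<omega>)
        = (\<Sum>a<N. \<Sum>b<N. word_entry (word_transpose (cut_at l v)) a b \<omega> * word_entry w b a \<omega>)"
      by (simp add: word_entry_transpose mult.commute)
    also have "\<dots> = word_trace (w @ word_transpose (cut_at l v)) \<omega>"
      by (simp only: sum_word_entry_mult word_trace_rotate)
    moreover have "(\<Sum>a<N. \<Sum>b<N. word_entry w b a \<omega> * word_entry (cut_at l v) a b \<omega>)
        = (\<Sum>a<N. \<Sum>b<N. word_entry (cut_at l v) a b \<omega> * word_entry w b a \<omega>)"
      by (simp add: mult.commute)
    moreover have "\<dots> = word_trace (w @ cut_at l v) \<omega>"
      by (simp only: sum_word_entry_mult word_trace_rotate)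
    ultimately show "(1 / real N) *
     (twisted_wt \<gamma> x (v ! l) * (\<Sum>a<N. \<Sum>b<N. word_entry w b a \<omega> * word_entry (cut_at l v) b a \<omega>)
    + straight_wt \<gamma> x (v ! l) * (\<Sum>a<N. \<Sum>b<N. word_entry w b a \<omega> * word_entry (cut_at l v) a b \<omega>))
    = (1 / real N) *
     (twisted_wt \<gamma> x (v ! l) * word_trace (w @ word_transpose (cut_at l v)) \<omega>
    + straight_wt \<gamma> x (v ! l) * word_trace (w @ cut_at l v) \<omega>)"
      by simp
  qed
  finally show ?thesis .
qed

text \<open>Contribution of pairing the first letter with letter \<open>l\<close> of trace
  \<open>j\<close>. The covariance 1/N has cancelled the N in the mean of the merged trace, so in
  each bracket the second term survives in the limit and the first is a correction.\<close>

definition splice_term :: "bool \<Rightarrow> bool list \<Rightarrow> bool list list \<Rightarrow> nat \<Rightarrow> nat \<Rightarrow> real" where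
  "splice_term x w vs j l =
     twisted_wt \<gamma> x (vs ! j ! l) *
       (centred_moment ((w @ word_transpose (cut_at l (vs ! j))) # skip_nth j vs) / real N
      + mean_trace (w @ word_transpose (cut_at l (vs ! j))) * centred_moment (skip_nth j vs))
   + straight_wt \<gamma> x (vs ! j ! l) *
       (centred_moment ((w @ cut_at l (vs ! j)) # skip_nth j vs) / real N
      + mean_trace (w @ cut_at l (vs ! j)) * centred_moment (skip_nth j vs))"

lemma expectation_splice:
  "expectation (\<lambda>\<omega>. \<Sum>a<N. \<Sum>b<N. word_entry w b a \<omega> *
      (\<Sum>j<length vs. word_trace_d x a b (vs ! j) \<omega> * centred_prod (skip_nth j vs) \<omega>))
   = (\<Sum>j<length vs. \<Sum>l<length (vs ! j). splice_term x w vs j l)"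
proof -
  let ?t = "\<lambda>j l \<omega>. (1 / real N) *
     (twisted_wt \<gamma> x (vs ! j ! l) * (word_trace (w @ word_transpose (cut_at l (vs ! j))) \<omega> * centred_prod (skip_nth j vs) \<omega>)
    + straight_wt \<gamma> x (vs ! j ! l) * (word_trace (w @ cut_at l (vs ! j)) \<omega> * centred_prod (skip_nth j vs) \<omega>))"
  note fm = finite_moments_sum finite_moments_mult finite_moments_add finite_moments_const
    word_trace_moments centred_prod_moments
  have "(\<Sum>a<N. \<Sum>b<N. word_entry w b a \<omega> *
      (\<Sum>j<length vs. word_trace_d x a b (vs ! j) \<omega> * centred_prod (skip_nth j vs) \<omega>))
    = (\<Sum>j<length vs. \<Sum>l<length (vs ! j). ?t j l \<omega>)" (is "?L = _") for \<omega>
  proof -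
    have "?L = (\<Sum>j<length vs. \<Sum>a<N. \<Sum>b<N. word_entry w b a \<omega> *
        (word_trace_d x a b (vs ! j) \<omega> * centred_prod (skip_nth j vs) \<omega>))"
      unfolding sum_distrib_left by (rule sum_swap3)
    also have "\<dots> = (\<Sum>j<length vs. (\<Sum>a<N. \<Sum>b<N. word_entry w b a \<omega> *
        word_trace_d x a b (vs ! j) \<omega>) * centred_prod (skip_nth j vs) \<omega>)"
      by (simp only: sum_distrib_right mult.assoc)
    finally show ?thesis
      unfolding sum_word_entry_trace_d by (simp only: sum_distrib_right distrib_right mult.assoc)
  qed
  then have "expectation (\<lambda>\<omega>. \<Sum>a<N. \<Sum>b<N. word_entry w b a \<omega> *
      (\<Sum>j<length vs. word_trace_d x a b (vs ! j) \<omega> * centred_prod (skip_nth j vs) \<omega>))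
    = expectation (\<lambda>\<omega>. \<Sum>j<length vs. \<Sum>l<length (vs ! j). ?t j l \<omega>)" by simp
  also have "\<dots> = (\<Sum>j<length vs. expectation (\<lambda>\<omega>. \<Sum>l<length (vs ! j). ?t j l \<omega>))"
    by (intro Bochner_Integration.integral_sum finite_moments_integrable fm)
  also have "\<dots> = (\<Sum>j<length vs. \<Sum>l<length (vs ! j). expectation (?t j l))"
    by (intro sum.cong refl Bochner_Integration.integral_sum finite_moments_integrable fm)
  also have "\<dots> = (\<Sum>j<length vs. \<Sum>l<length (vs ! j). splice_term x w vs j l)"
  proof (intro sum.cong refl)
    fix j l
    let ?A = "\<lambda>\<omega>. word_trace (w @ word_transpose (cut_at l (vs ! j))) \<omega> * centred_prod (skip_nth j vs) \<omega>"
    let ?B = "\<lambda>\<omega>. word_trace (w @ cut_at l (vs ! j)) \<omega> * centred_prod (skip_nth j vs) \<omega>"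
    have "integrable M ?A" "integrable M ?B"
      by (intro finite_moments_integrable fm)+
    then have "expectation (?t j l) = (1 / real N) * (twisted_wt \<gamma> x (vs ! j ! l) * expectation ?A
       + straight_wt \<gamma> x (vs ! j ! l) * expectation ?B)" by simp
    then show "expectation (?t j l) = splice_term x w vs j l"
      unfolding expectation_trace_centred splice_term_def using N_pos by (simp add: field_simps)
  qed
  finally show ?thesis .
qed

lemma expectation_trace_Cons_centred:
  "expectation (\<lambda>\<omega>. word_trace (x # w) \<omega> * centred_prod vs \<omega>) =
    (\<Sum>l<length w. (1 / real N) *
      (straight_wt \<gamma> x (w ! l) * (centred_moment (take l w # drop (Suc l) w # vs)
         + real N * mean_trace (take l w) * centred_moment (drop (Suc l) w # vs)
         + real N * mean_trace (drop (Suc l) w) * centred_moment (take l w # vs)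
         + real N * mean_trace (take l w) * (real N * mean_trace (drop (Suc l) w)) * centred_moment vs)
     + twisted_wt \<gamma> x (w ! l) * (centred_moment ((word_transpose (take l w) @ drop (Suc l) w) # vs)
         + real N * mean_trace (word_transpose (take l w) @ drop (Suc l) w) * centred_moment vs)))
    + (\<Sum>j<length vs. \<Sum>l<length (vs ! j). splice_term x w vs j l)"
  by (subst schwinger_dyson[OF has_d_centred_prod])
     (simp_all only: expectation_splice expectation_trace_trace_centred expectation_trace_centred)

lemma centred_moment_Nil: "centred_moment [] = 1"
  by (simp add: centred_moment_def prob_space)

lemma centred_moment_single: "centred_moment [w] = 0"
  using expectation_trace_centred[of w "[]"]
  by (simp add: centred_moment_Nil expectation_word_trace)

lemma expectation_trace_Cons:
  "expectation (word_trace (x # w)) =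
    (\<Sum>l<length w. (1 / real N) *
      (straight_wt \<gamma> x (w ! l) * (centred_moment [take l w, drop (Suc l) w]
         + real N * mean_trace (take l w) * (real N * mean_trace (drop (Suc l) w)))
     + twisted_wt \<gamma> x (w ! l) * (real N * mean_trace (word_transpose (take l w) @ drop (Suc l) w))))"
  using expectation_trace_Cons_centred[of x w "[]"]
  by (simp add: centred_moment_Nil centred_moment_single del: word_entry.simps)

text \<open>After division by N the product of two means is the only term without a negative power
  of N: twisted pairings lose 1/N, and the covariance of the two pieces loses 1/N^2.\<close>

lemma mean_trace_Cons:
  "mean_trace (x # w) =
    (\<Sum>l<length w. straight_wt \<gamma> x (w ! l) * (centred_moment [take l w, drop (Suc l) w] / real N / real N
         + mean_trace (take l w) * mean_trace (drop (Suc l) w))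
     + twisted_wt \<gamma> x (w ! l) * (mean_trace (word_transpose (take l w) @ drop (Suc l) w) / real N))"
  unfolding mean_trace_def[of "x # w"] expectation_trace_Cons sum_divide_distrib
  using N_pos by (intro sum.cong refl) (simp add: field_simps)

text \<open>Subtracting the mean of the first trace removes the products of two means, which carry a
  factor N, and the means of the twisted remainders. The terms that survive have coefficients
  bounded in N, on which the later induction rests.\<close>

lemma centred_moment_Cons:
  "centred_moment ((x # w) # vs) =
    (\<Sum>l<length w.
       straight_wt \<gamma> x (w ! l) * ((centred_moment (take l w # drop (Suc l) w # vs)
            - centred_moment [take l w, drop (Suc l) w] * centred_moment vs) / real N
         + mean_trace (take l w) * centred_moment (drop (Suc l) w # vs)
         + mean_trace (drop (Suc l) w) * centred_moment (take l w # vs))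
     + twisted_wt \<gamma> x (w ! l) * (centred_moment ((word_transpose (take l w) @ drop (Suc l) w) # vs) / real N))
    + (\<Sum>j<length vs. \<Sum>l<length (vs ! j). splice_term x w vs j l)" (is "_ = ?rhs")
proof -
  have diff_of_sums: "sum f A + r - sum g A = sum h A + r" if "\<And>l. f l - g l = h l"
    for f g h :: "nat \<Rightarrow> real" and A r
  proof -
    have "sum f A - sum g A = sum h A" using that by (simp flip: sum_subtractf)
    then show ?thesis by simp
  qed
  have "centred_moment ((x # w) # vs) = expectation (\<lambda>\<omega>. word_trace (x # w) \<omega> * centred_prod vs \<omega>)
     - expectation (word_trace (x # w)) * centred_moment vs"
    unfolding expectation_trace_centred expectation_word_trace by simp
  also have "\<dots> = ?rhs"
    unfolding expectation_trace_Cons_centred expectation_trace_Cons sum_distrib_right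
    by (rule diff_of_sums) (use N_pos in \<open>simp add: field_simps\<close>)
  finally show ?thesis .
qed

lemma centred_moment_Nil_Cons: "centred_moment ([] # vs) = 0"
proof -
  have "word_trace [] = (\<lambda>_. real N)" by (simp add: word_trace_def)
  then show ?thesis by (simp add: centred_moment_def prob_space)
qed

lemma mean_trace_Nil: "mean_trace [] = 1"
proof -
  have "word_trace [] = (\<lambda>_. real N)" by (simp add: word_trace_def)
  then show ?thesis using N_pos by (simp add: mean_trace_def prob_space)
qed

end
section \<open>Moments of Gaussian pairs\<close>

text \<open>The two-step recursion covers all cases uniformly: odd moments vanish, consecutive even
  ones have ratio (n+1) \<sigma>^2, and for the point mass at \<sigma> = 0 both sides are
  zero.\<close>

lemma gaussian_measure_moments:
  assumes "\<sigma> \<ge> 0"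
  shows "integrable (gaussian_measure 0 \<sigma>) (\<lambda>x. x ^ n)"
    and "(\<integral>x. x ^ Suc (Suc n) \<partial>gaussian_measure 0 \<sigma>) = real (Suc n) * \<sigma>\<^sup>2 * (\<integral>x. x ^ n \<partial>gaussian_measure 0 \<sigma>)"
proof -
  have "integrable (gaussian_measure 0 \<sigma>) (\<lambda>x. x ^ n) \<and>
   (\<integral>x. x ^ Suc (Suc n) \<partial>gaussian_measure 0 \<sigma>) = real (Suc n) * \<sigma>\<^sup>2 * (\<integral>x. x ^ n \<partial>gaussian_measure 0 \<sigma>)"
  proof (cases "\<sigma> = 0")
    case True
    interpret prob_space "return borel (0::real)" by (rule prob_space_return) simp
    have "integrable (return borel (0::real)) (\<lambda>x. x ^ n)"
      by (rule integrable_const_bound[of _ "\<bar>0 ^ n\<bar>"]) (simp_all add: AE_return)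
    then show ?thesis by (simp add: gaussian_measure_def True integral_return)
  next
    case False
    then have pos: "\<sigma> > 0" using assms by simp
    have int: "integrable (gaussian_measure 0 \<sigma>) (\<lambda>x. x ^ n)" for n
      using integrable_normal_moment[OF pos, of 0 n] False
      by (simp add: gaussian_measure_def integrable_density normal_density_nonneg)
    have eq: "(\<integral>x. x ^ n \<partial>gaussian_measure 0 \<sigma>) = (\<integral>x. normal_density 0 \<sigma> x * (x - 0) ^ n \<partial>lborel)" for n
      using False by (simp add: gaussian_measure_def integral_density normal_density_nonneg)
    show ?thesis
    proof (cases "even n")
      case True
      then obtain k where k: "n = 2 * k" by (rule evenE)
      have "(\<integral>x. x ^ Suc (Suc n) \<partial>gaussian_measure 0 \<sigma>) = fact (2 * Suc k) / ((2 / \<sigma>\<^sup>2) ^ Suc k * fact (Suc k))"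
        unfolding eq using integral_normal_moment_even[OF pos, of 0 "Suc k"] by (simp add: k)
      moreover have "(\<integral>x. x ^ n \<partial>gaussian_measure 0 \<sigma>) = fact (2 * k) / ((2 / \<sigma>\<^sup>2) ^ k * fact k)"
        unfolding eq k by (rule integral_normal_moment_even[OF pos])
      moreover have "fact (2 * Suc k) / ((2 / \<sigma>\<^sup>2) ^ Suc k * fact (Suc k))
          = real (Suc n) * \<sigma>\<^sup>2 * (fact (2 * k) / ((2 / \<sigma>\<^sup>2) ^ k * fact k))"
      proof -
        have "2 * r * (a * b) / (2 / s * x * (r * d)) = a * s * (b / (x * d))"
          if "s \<noteq> 0" "r \<noteq> 0" "x \<noteq> 0" "d \<noteq> 0" for a b d r s x :: real
          using that by (simp add: field_simps)
        from this[of "\<sigma>\<^sup>2" "real (Suc k)" "(2 / \<sigma>\<^sup>2) ^ k" "fact k" "real (Suc n)" "fact (2 * k)"]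
        show ?thesis using pos by (simp add: k mult_ac del: power_divide)
      qed
      ultimately show ?thesis using int by simp
    next
      case False
      then obtain k where k: "n = 2 * k + 1" by (rule oddE)
      have "(\<integral>x. x ^ Suc (Suc n) \<partial>gaussian_measure 0 \<sigma>) = 0"
        unfolding eq using integral_normal_moment_odd[OF pos, of 0 "Suc k"] by (simp add: k)
      moreover have "(\<integral>x. x ^ n \<partial>gaussian_measure 0 \<sigma>) = 0"
        unfolding eq using integral_normal_moment_odd[OF pos, of 0 k] by (simp add: k)
      ultimately show ?thesis using int by simp
    qed
  qed
  then show "integrable (gaussian_measure 0 \<sigma>) (\<lambda>x. x ^ n)"
    "(\<integral>x. x ^ Suc (Suc n) \<partial>gaussian_measure 0 \<sigma>) = real (Suc n) * \<sigma>\<^sup>2 * (\<integral>x. x ^ n \<partial>gaussian_measure 0 \<sigma>)"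
    by auto
qed

lemma gaussian_measure_mean:
  assumes "\<sigma> \<ge> 0"
  shows "(\<integral>x. x \<partial>gaussian_measure \<mu> \<sigma>) = \<mu>"
proof (cases "\<sigma> = 0")
  case False
  then have "\<sigma> > 0" using assms by simp
  then show ?thesis
    using False integral_normal_moment_nz_1[of \<sigma> \<mu>]
    by (simp add: gaussian_measure_def integral_density normal_density_nonneg)
qed (simp add: gaussian_measure_def integral_return)

text \<open>The parameter \<sigma>^2 is replaced by the second moment, so the recursion applies to
  every linear combination of a Gaussian pair without naming its law.\<close>

lemma (in prob_space) centred_gaussian_moments:
  assumes "gaussian_rv M Z" and "expectation Z = 0"
  shows "finite_moments M Z"
    and "expectation (\<lambda>\<omega>. Z \<omega> ^ Suc (Suc n)) = real (Suc n) * expectation (\<lambda>\<omega>. (Z \<omega>)\<^sup>2) * expectation (\<lambda>\<omega>. Z \<omega> ^ n)"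
proof -
  from assms(1) obtain \<mu> \<sigma> where \<sigma>: "\<sigma> \<ge> 0" and d: "distr M borel Z = gaussian_measure \<mu> \<sigma>"
    and meas [measurable]: "Z \<in> borel_measurable M"
    unfolding gaussian_rv_def by auto
  have "expectation Z = (\<integral>x. x \<partial>distr M borel Z)" by (simp add: integral_distr)
  then have "\<mu> = 0" using assms(2) gaussian_measure_mean[OF \<sigma>] d by simp
  with d have d: "distr M borel Z = gaussian_measure 0 \<sigma>" by simp
  have eq: "expectation (\<lambda>\<omega>. Z \<omega> ^ n) = (\<integral>x. x ^ n \<partial>gaussian_measure 0 \<sigma>)" for n
    unfolding d[symmetric] by (simp add: integral_distr)
  have "integrable M (\<lambda>\<omega>. Z \<omega> ^ n)" for n
    using gaussian_measure_moments(1)[OF \<sigma>, of n] unfolding d[symmetric] by (simp add: integrable_distr_eq)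
  then show "finite_moments M Z" by (simp add: finite_moments_def meas)
  have "expectation (\<lambda>\<omega>. (Z \<omega>)\<^sup>2) = \<sigma>\<^sup>2"
  proof -
    have "(\<integral>x. x ^ 0 \<partial>gaussian_measure 0 \<sigma>) = 1"
      unfolding eq[symmetric] by (simp add: prob_space)
    then show ?thesis using gaussian_measure_moments(2)[OF \<sigma>, of 0] unfolding eq by (simp add: numeral_2_eq_2)
  qed
  then show "expectation (\<lambda>\<omega>. Z \<omega> ^ Suc (Suc n)) = real (Suc n) * expectation (\<lambda>\<omega>. (Z \<omega>)\<^sup>2) * expectation (\<lambda>\<omega>. Z \<omega> ^ n)"
    unfolding eq[of "Suc (Suc n)"] eq[of n] using gaussian_measure_moments(2)[OF \<sigma>] by simp
qed

text \<open>
  The moments of the linear combinations \<open>a U + V\<close> are polynomials in \<open>a\<close> whose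
  coefficients are the mixed moments of \<open>U\<close> and \<open>V\<close>; differentiating the moment recursion
  in \<open>a\<close> and comparing coefficients gives the integration by parts formula.
\<close>

lemma (in prob_space) gaussian_pair_moments:
  assumes G: "gaussian_pair M U V" and EU: "expectation U = 0" and EV: "expectation V = 0"
    and EUU: "expectation (\<lambda>\<omega>. (U \<omega>)\<^sup>2) = 1" and EVV: "expectation (\<lambda>\<omega>. (V \<omega>)\<^sup>2) = 1"
    and EUV: "expectation (\<lambda>\<omega>. U \<omega> * V \<omega>) = \<gamma>"
  shows "finite_moments M U" "finite_moments M V"
    and "expectation (\<lambda>\<omega>. U \<omega> ^ Suc k * V \<omega> ^ l)
      = real k * expectation (\<lambda>\<omega>. U \<omega> ^ (k - 1) * V \<omega> ^ l)
        + \<gamma> * real l * expectation (\<lambda>\<omega>. U \<omega> ^ k * V \<omega> ^ (l - 1))"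
proof -
  have lin: "gaussian_rv M (\<lambda>\<omega>. a * U \<omega> + b * V \<omega>)" for a b
    using G by (simp add: gaussian_pair_def)
  show fU: "finite_moments M U" using centred_gaussian_moments(1)[of U] lin[of 1 0] EU by simp
  show fV: "finite_moments M V" using centred_gaussian_moments(1)[of V] lin[of 0 1] EV by simp
  define m where "m k l = expectation (\<lambda>\<omega>. U \<omega> ^ k * V \<omega> ^ l)" for k l
  define P where "P n = (\<Sum>k\<le>n. monom (real (n choose k) * m k (n - k)) k)" for n
  have coeff_P: "coeff (P n) k = (if k \<le> n then real (n choose k) * m k (n - k) else 0)" for n k
    unfolding P_def coeff_sum coeff_monom by (simp add: sum.delta')
  have poly_P: "poly (P n) a = expectation (\<lambda>\<omega>. (a * U \<omega> + 1 * V \<omega>) ^ n)" for n a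
  proof -
    have "expectation (\<lambda>\<omega>. (a * U \<omega> + 1 * V \<omega>) ^ n)
      = expectation (\<lambda>\<omega>. \<Sum>k\<le>n. real (n choose k) * a ^ k * (U \<omega> ^ k * V \<omega> ^ (n - k)))"
      by (simp add: binomial_ring power_mult_distrib mult_ac)
    also have "\<dots> = (\<Sum>k\<le>n. real (n choose k) * a ^ k * m k (n - k))"
      unfolding m_def using finite_moments_integrable_mono[OF fU fV]
      by (subst Bochner_Integration.integral_sum) auto
    finally show ?thesis by (simp add: P_def poly_sum poly_monom mult_ac)
  qed
  define K :: "real \<Rightarrow> real poly" where "K c = [:c:]" for c
  \<comment> \<open>\<open>Q\<close> is the variance of aU + V as a polynomial in a, and
    \<open>A\<close> is half its derivative.\<close>
  define A where "A = [:\<gamma>, 1:]"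
  define Q where "Q = [:1, 2 * \<gamma>, 1:]"
  have K_mult: "K (c * d) = K c * K d" and K_add: "K (c + d) = K c + K d" and K_d: "pderiv (K c) = 0" for c d
    by (simp_all add: K_def pderiv_pCons)
  have Q_d: "pderiv Q = K 2 * A" by (simp add: Q_def K_def A_def pderiv_pCons)
  have P_rec: "P (Suc (Suc n)) = K (real (Suc n)) * (Q * P n)" for n
  proof -
    have "poly (P (Suc (Suc n))) a = poly (K (real (Suc n)) * (Q * P n)) a" for a
    proof -
      have int: "integrable M U" "integrable M V" "integrable M (\<lambda>\<omega>. (U \<omega>)\<^sup>2)" "integrable M (\<lambda>\<omega>. (V \<omega>)\<^sup>2)"
        "integrable M (\<lambda>\<omega>. U \<omega> * V \<omega>)"
        using fU fV by (auto intro: finite_moments_integrable finite_moments_integrable_power finite_moments_mult)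
      have "expectation (\<lambda>\<omega>. a * U \<omega> + 1 * V \<omega>) = 0" using int EU EV by simp
      note rec = centred_gaussian_moments(2)[OF lin this, of n]
      have "expectation (\<lambda>\<omega>. (a * U \<omega> + 1 * V \<omega>)\<^sup>2)
         = expectation (\<lambda>\<omega>. a\<^sup>2 * (U \<omega>)\<^sup>2 + 2 * a * (U \<omega> * V \<omega>) + (V \<omega>)\<^sup>2)"
        by (simp add: power2_eq_square algebra_simps)
      also have "\<dots> = a\<^sup>2 + 2 * a * \<gamma> + 1" using int by (simp add: EUU EVV EUV)
      finally show ?thesis
        using rec unfolding poly_mult poly_P by (simp add: K_def Q_def power2_eq_square algebra_simps)
    qed
    then show ?thesis by (metis poly_eq_poly_eq_iff ext)
  qed
  have "P 0 = 1" by (simp add: P_def m_def prob_space monom_0)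
  have P1: "P 1 = 0"
    using EU EV by (simp add: P_def m_def)
  \<comment> \<open>Differentiating \<open>P_rec\<close> gives (n+1) (2 A P_n + Q P_n'). By
    induction and a second use of \<open>P_rec\<close>, Q P_n' = n A P_n, so the factors add up to
    (n+1)(n+2).\<close>
  have dP: "pderiv (P (Suc (Suc n))) = K (real (Suc (Suc n)) * real (Suc n)) * (A * P n)" for n
  proof (induction n rule: less_induct)
    case (less n)
    have eq: "pderiv (P (Suc (Suc n))) = K (real (Suc n)) * (K 2 * (A * P n) + Q * pderiv (P n))"
      unfolding P_rec pderiv_mult K_d Q_d by (simp add: mult_ac)
    have "Q * pderiv (P n) = K (real n) * (A * P n)"
    proof -
      consider "n = 0" | "n = 1" | k where "n = Suc (Suc k)"
        by (cases n; cases "n - 1") auto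
      then show ?thesis
      proof cases
        case 1
        then show ?thesis by (simp add: \<open>P 0 = 1\<close> K_def)
      next
        case 2
        then show ?thesis by (simp add: P1[simplified])
      next
        case 3
        have "Q * pderiv (P n) = K (real n) * (A * (K (real (Suc k)) * (Q * P k)))"
          unfolding 3 less.IH[of k, unfolded 3, OF less_SucI[OF lessI]] K_mult by (simp only: mult_ac)
        then show ?thesis unfolding 3 P_rec[symmetric] .
      qed
    qed
    then have "pderiv (P (Suc (Suc n))) = K (real (Suc n)) * (K 2 + K (real n)) * (A * P n)"
      unfolding eq by (simp only: distrib_left distrib_right mult_ac)
    also have "K (real (Suc n)) * (K 2 + K (real n)) = K (real (Suc (Suc n)) * real (Suc n))"
      unfolding K_mult[symmetric] K_add[symmetric] by (simp add: algebra_simps)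
    finally show ?case .
  qed
  show "expectation (\<lambda>\<omega>. U \<omega> ^ Suc k * V \<omega> ^ l)
      = real k * expectation (\<lambda>\<omega>. U \<omega> ^ (k - 1) * V \<omega> ^ l)
        + \<gamma> * real l * expectation (\<lambda>\<omega>. U \<omega> ^ k * V \<omega> ^ (l - 1))"
  proof (cases "k + l")
    case 0
    then show ?thesis using EU by simp
  next
    case (Suc n)
    \<comment> \<open>The coefficients of a^k are compared, where k + l = n + 1. All terms share the
      nonzero factor (n+2) binom(n+1, k), which is cancelled at the end.\<close>
    have "coeff (pderiv (P (Suc (Suc n)))) k = real (Suc k) * (real (Suc (Suc n) choose Suc k) * m (Suc k) l)"
      using Suc by (simp add: coeff_pderiv coeff_P flip: Suc)
    also have "\<dots> = real (Suc (Suc n)) * (real (Suc n choose k) * m (Suc k) l)"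
      unfolding mult.assoc[symmetric] of_nat_mult[symmetric] Suc_times_binomial ..
    finally have lhs: "coeff (pderiv (P (Suc (Suc n)))) k = real (Suc (Suc n)) * (real (Suc n choose k) * m (Suc k) l)" .
    have "coeff (A * P n) k = \<gamma> * coeff (P n) k + (if k = 0 then 0 else coeff (P n) (k - 1))"
      by (cases k) (simp_all add: A_def mult_pCons_left)
    moreover have "real (Suc n) * coeff (P n) k = real (Suc n choose k) * (real l * m k (l - 1))"
    proof (cases "k \<le> n")
      case True
      have "(Suc n - k) * (Suc n choose k) = Suc n * (n choose k)"
        using binomial_absorb_comp[of "Suc n" k] by (simp only: diff_Suc_1)
      also have "Suc n - k = l" using Suc by simp
      finally have "real (l * (Suc n choose k)) = real (Suc n * (n choose k))" by (simp only:)
      then have "real (Suc n) * real (n choose k) = real l * real (Suc n choose k)"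
        by (simp only: of_nat_mult)
      moreover have "n - k = l - 1" using Suc True by simp
      ultimately show ?thesis using True by (simp add: coeff_P mult.assoc[symmetric] del: of_nat_Suc)
    next
      case False
      then have "l = 0" using Suc by simp
      then show ?thesis using False by (simp add: coeff_P)
    qed
    moreover have "real (Suc n) * (if k = 0 then 0 else coeff (P n) (k - 1)) = real (Suc n choose k) * (real k * m (k - 1) l)"
    proof (cases k)
      case k: (Suc k')
      have "k * (Suc n choose k) = Suc n * (n choose k')"
        unfolding k by (rule Suc_times_binomial)
      then have "real (k * (Suc n choose k)) = real (Suc n * (n choose k'))" by (simp only:)
      then have "real (Suc n) * real (n choose k') = real k * real (Suc n choose k)"
        by (simp only: of_nat_mult)
      moreover have "n - k' = l" "k' \<le> n" using Suc k by auto
      ultimately show ?thesis using k by (simp add: coeff_P mult.assoc[symmetric] del: of_nat_Suc)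
    qed simp
    ultimately have "real (Suc n) * coeff (A * P n) k
      = real (Suc n choose k) * (real k * m (k - 1) l + \<gamma> * real l * m k (l - 1))"
      by (simp only: distrib_left mult_ac)
    moreover have "coeff (K c * p) k = c * coeff p k" for c p by (simp add: K_def)
    ultimately have "real (Suc (Suc n)) * (real (Suc n choose k) * m (Suc k) l)
      = real (Suc (Suc n)) * (real (Suc n choose k) * (real k * m (k - 1) l + \<gamma> * real l * m k (l - 1)))"
      unfolding lhs[symmetric] dP by (simp only: mult.assoc)
    moreover have "real (Suc n choose k) \<noteq> 0" "real (Suc (Suc n)) \<noteq> 0" using Suc by simp_all
    ultimately have "m (Suc k) l = real k * m (k - 1) l + \<gamma> * real l * m k (l - 1)"
      by (simp only: mult_cancel_left simp_thms)
    then show ?thesis by (simp only: m_def)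
  qed
qed

section \<open>Wick's formula for elliptic matrices\<close>

lemma monom_rv_two:
  assumes "e \<noteq> e'" "set es \<subseteq> {e, e'}"
  shows "monom_rv y es \<omega> = y e \<omega> ^ count_list es e * y e' \<omega> ^ count_list es e'"
  using assms by (induction es) auto

text \<open>The product rule for u^a v^b; a truncated exponent 0 - 1 is harmless because it comes
  with the factor 0.\<close>

lemma dmonom_rv_two:
  assumes "e \<noteq> e'" "set es \<subseteq> {e, e'}"
  shows "dmonom_rv d y es \<omega> =
      d e * (real (count_list es e) * (y e \<omega> ^ (count_list es e - 1) * y e' \<omega> ^ count_list es e'))
    + d e' * (real (count_list es e') * (y e \<omega> ^ count_list es e * y e' \<omega> ^ (count_list es e' - 1)))"
  using assms(2)
proof (induction es)
  case (Cons f es)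
  have pow: "x * (real n * x ^ (n - 1)) = real n * x ^ n" for x :: real and n
    by (cases n) simp_all
  let ?u = "y e \<omega>" and ?v = "y e' \<omega>" and ?a = "count_list es e" and ?b = "count_list es e'"
  have IH: "dmonom_rv d y es \<omega> = d e * (real ?a * (?u ^ (?a - 1) * ?v ^ ?b)) + d e' * (real ?b * (?u ^ ?a * ?v ^ (?b - 1)))"
    and mon: "monom_rv y es \<omega> = ?u ^ ?a * ?v ^ ?b"
    using Cons monom_rv_two[OF assms(1)] by auto
  from Cons.prems consider "f = e" | "f = e'" by auto
  then show ?case
  proof cases
    case 1
    have "dmonom_rv d y (f # es) \<omega> = d e * (?u ^ ?a * ?v ^ ?b) + (d e * ((?u * (real ?a * ?u ^ (?a - 1))) * ?v ^ ?b)
        + d e' * (real ?b * ((?u * ?u ^ ?a) * ?v ^ (?b - 1))))"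
      unfolding dmonom_rv.simps IH mon 1 by (simp only: distrib_left mult_ac)
    then show ?thesis unfolding pow using 1 assms(1) by (simp add: algebra_simps)
  next
    case 2
    have "dmonom_rv d y (f # es) \<omega> = d e' * (?u ^ ?a * ?v ^ ?b) + (d e * (real ?a * (?u ^ (?a - 1) * (?v * ?v ^ ?b)))
        + d e' * (?u ^ ?a * (?v * (real ?b * ?v ^ (?b - 1)))))"
      unfolding dmonom_rv.simps IH mon 2 by (simp only: distrib_left mult_ac)
    then show ?thesis unfolding pow using 2 assms(1) by (simp add: algebra_simps)
  qed
qed simp

lemma monom_rv_filter:
  "monom_rv y es \<omega> = monom_rv y (filter P es) \<omega> * monom_rv y (filter (\<lambda>x. \<not> P x) es) \<omega>"
  by (induction es) auto

text \<open>Variables on which \<open>d\<close> vanishes are constants for the derivation, so the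
  part of the monomial built from them factors out. This isolates the entries correlated with a
  given one.\<close>

lemma dmonom_rv_filter:
  "(\<And>e. e \<in> set es \<Longrightarrow> \<not> P e \<Longrightarrow> d e = 0) \<Longrightarrow>
    dmonom_rv d y es \<omega> = dmonom_rv d y (filter P es) \<omega> * monom_rv y (filter (\<lambda>x. \<not> P x) es) \<omega>"
proof (induction es)
  case (Cons e es)
  then have IH: "dmonom_rv d y es \<omega> = dmonom_rv d y (filter P es) \<omega> * monom_rv y (filter (\<lambda>x. \<not> P x) es) \<omega>"
    by simp
  show ?case
  proof (cases "P e")
    case True
    then show ?thesis using monom_rv_filter[of y es \<omega> P] by (simp add: IH distrib_left distrib_right mult_ac)
  next
    case False
    then have "d e = 0" using Cons.prems by simp
    then show ?thesis using False by (simp add: IH)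
  qed
qed simp

lemma monom_rv_scale: "monom_rv (\<lambda>e \<omega>. r * y e \<omega>) es \<omega> = r ^ length es * monom_rv y es \<omega>"
  by (induction es) simp_all

text \<open>The derivation trades a variable of weight r for a covariance of weight r^2, hence an
  exponent one above the length.\<close>

lemma dmonom_rv_scale:
  "dmonom_rv (\<lambda>e. r\<^sup>2 * d e) (\<lambda>e \<omega>. r * y e \<omega>) es = (\<lambda>\<omega>. r ^ Suc (length es) * dmonom_rv d y es \<omega>)"
  by (induction es) (simp_all add: monom_rv_scale algebra_simps power2_eq_square)

section \<open>Independence of the pairs of opposite entries\<close>

definition upper_pos :: "nat \<times> nat \<Rightarrow> nat \<times> nat" where
  "upper_pos e = (if fst e \<le> snd e then e else prod.swap e)"

text \<open>Recovers an entry from the family of pairs indexed by i \<le> j. Monomials thereby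
  become measurable functions on a product space, the form in which independence over disjoint index
  sets can be applied.\<close>

definition pair_entry :: "nat \<times> nat \<Rightarrow> (nat \<times> nat \<Rightarrow> real \<times> real) \<Rightarrow> real" where
  "pair_entry e z = (if fst e \<le> snd e then fst (z (upper_pos e)) else snd (z (upper_pos e)))"

lemma pair_entry_measurable:
  assumes "upper_pos e \<in> A"
  shows "pair_entry e \<in> borel_measurable (Pi\<^sub>M A (\<lambda>_. borel :: (real \<times> real) measure))"
proof -
  have m: "(\<lambda>z. z (upper_pos e)) \<in> measurable (Pi\<^sub>M A (\<lambda>_. borel :: (real \<times> real) measure)) (borel \<Otimes>\<^sub>M borel)"
    unfolding borel_prod by (rule measurable_component_singleton[OF assms])
  have "(\<lambda>z. fst (z (upper_pos e))) \<in> borel_measurable (Pi\<^sub>M A (\<lambda>_. borel :: (real \<times> real) measure))"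
    "(\<lambda>z. snd (z (upper_pos e))) \<in> borel_measurable (Pi\<^sub>M A (\<lambda>_. borel :: (real \<times> real) measure))"
    by (rule measurable_compose[OF m measurable_fst], rule measurable_compose[OF m measurable_snd])
  then show ?thesis unfolding pair_entry_def by (cases "fst e \<le> snd e") simp_all
qed

lemma monom_rv_measurable:
  "upper_pos ` set es \<subseteq> A \<Longrightarrow> monom_rv pair_entry es \<in> borel_measurable (Pi\<^sub>M A (\<lambda>_. borel))"
  by (induction es) (auto intro!: borel_measurable_times pair_entry_measurable)

lemma dmonom_rv_measurable:
  "upper_pos ` set es \<subseteq> A \<Longrightarrow> dmonom_rv d pair_entry es \<in> borel_measurable (Pi\<^sub>M A (\<lambda>_. borel))"
  by (induction es)
     (auto intro!: borel_measurable_add borel_measurable_times pair_entry_measurable monom_rv_measurable)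

lemma pair_entry_restrict:
  "upper_pos e \<in> A \<Longrightarrow> pair_entry e (restrict (\<lambda>p. (y p \<omega>, y (prod.swap p) \<omega>)) A) = y e \<omega>"
  by (cases "fst e \<le> snd e") (simp_all add: pair_entry_def upper_pos_def)

lemma monom_rv_restrict:
  "upper_pos ` set es \<subseteq> A \<Longrightarrow>
    monom_rv pair_entry es (restrict (\<lambda>p. (y p \<omega>, y (prod.swap p) \<omega>)) A) = monom_rv y es \<omega>"
  by (induction es) (auto simp: pair_entry_restrict)

lemma dmonom_rv_restrict:
  "upper_pos ` set es \<subseteq> A \<Longrightarrow>
    dmonom_rv d pair_entry es (restrict (\<lambda>p. (y p \<omega>, y (prod.swap p) \<omega>)) A) = dmonom_rv d y es \<omega>"
  by (induction es) (auto simp: pair_entry_restrict monom_rv_restrict)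

lemma (in prob_space) expectation_mult_disjoint:
  fixes f g :: "(nat \<times> nat \<Rightarrow> real \<times> real) \<Rightarrow> real"
  assumes ind: "indep_vars (\<lambda>_. borel :: (real \<times> real) measure) (\<lambda>p \<omega>. (y p \<omega>, y (prod.swap p) \<omega>)) I"
    and AB: "A \<inter> B = {}" "A \<subseteq> I" "B \<subseteq> I"
    and f: "f \<in> borel_measurable (Pi\<^sub>M A (\<lambda>_. borel))" and g: "g \<in> borel_measurable (Pi\<^sub>M B (\<lambda>_. borel))"
    and F: "\<And>\<omega>. F \<omega> = f (restrict (\<lambda>p. (y p \<omega>, y (prod.swap p) \<omega>)) A)"
    and G: "\<And>\<omega>. G \<omega> = g (restrict (\<lambda>p. (y p \<omega>, y (prod.swap p) \<omega>)) B)"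
    and int: "integrable M F" "integrable M G"
  shows "expectation (\<lambda>\<omega>. F \<omega> * G \<omega>) = expectation F * expectation G"
proof -
  have "indep_var borel (f \<circ> (\<lambda>\<omega>. restrict (\<lambda>p. (y p \<omega>, y (prod.swap p) \<omega>)) A))
      borel (g \<circ> (\<lambda>\<omega>. restrict (\<lambda>p. (y p \<omega>, y (prod.swap p) \<omega>)) B))"
    by (rule indep_var_compose[OF indep_var_restrict[OF ind AB] f g])
  moreover have "f \<circ> (\<lambda>\<omega>. restrict (\<lambda>p. (y p \<omega>, y (prod.swap p) \<omega>)) A) = F"
    "g \<circ> (\<lambda>\<omega>. restrict (\<lambda>p. (y p \<omega>, y (prod.swap p) \<omega>)) B) = G"
    by (simp_all add: fun_eq_iff F G)
  ultimately have "indep_var borel F borel G" by (simp only:)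
  then show ?thesis using int by (rule indep_var_lebesgue_integral)
qed

lemma gaussian_elliptic_offdiag:
  assumes "gaussian_elliptic M \<gamma> N Y" "i \<noteq> j" "i < N" "j < N"
  shows "gaussian_pair M (\<lambda>\<omega>. Y \<omega> $$ (i, j)) (\<lambda>\<omega>. Y \<omega> $$ (j, i)) \<and>
        integral\<^sup>L M (\<lambda>\<omega>. Y \<omega> $$ (i, j)) = 0 \<and>
        integral\<^sup>L M (\<lambda>\<omega>. Y \<omega> $$ (j, i)) = 0 \<and>
        integral\<^sup>L M (\<lambda>\<omega>. (Y \<omega> $$ (i, j))\<^sup>2) = 1 \<and>
        integral\<^sup>L M (\<lambda>\<omega>. (Y \<omega> $$ (j, i))\<^sup>2) = 1 \<and>
        integral\<^sup>L M (\<lambda>\<omega>. Y \<omega> $$ (i, j) * Y \<omega> $$ (j, i)) = \<gamma>"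
proof (cases "i < j")
  case True
  then show ?thesis using assms by (simp add: gaussian_elliptic_def)
next
  case False
  then have "j < i" using assms by simp
  then have *: "gaussian_pair M (\<lambda>\<omega>. Y \<omega> $$ (j, i)) (\<lambda>\<omega>. Y \<omega> $$ (i, j))"
    and **: "integral\<^sup>L M (\<lambda>\<omega>. Y \<omega> $$ (i, j)) = 0 \<and>
        integral\<^sup>L M (\<lambda>\<omega>. Y \<omega> $$ (j, i)) = 0 \<and>
        integral\<^sup>L M (\<lambda>\<omega>. (Y \<omega> $$ (i, j))\<^sup>2) = 1 \<and>
        integral\<^sup>L M (\<lambda>\<omega>. (Y \<omega> $$ (j, i))\<^sup>2) = 1 \<and>
        integral\<^sup>L M (\<lambda>\<omega>. Y \<omega> $$ (j, i) * Y \<omega> $$ (i, j)) = \<gamma>"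
    using assms by (simp_all add: gaussian_elliptic_def)
  from * have "gaussian_pair M (\<lambda>\<omega>. Y \<omega> $$ (i, j)) (\<lambda>\<omega>. Y \<omega> $$ (j, i))"
    unfolding gaussian_pair_def by (subst add.commute) blast
  with ** show ?thesis by (simp add: mult.commute)
qed

lemma gaussian_elliptic_entry_moments:
  assumes "gaussian_elliptic M \<gamma> N Y" "e \<in> {..<N} \<times> {..<N}"
  shows "finite_moments M (\<lambda>\<omega>. Y \<omega> $$ e)"
proof -
  interpret prob_space M using assms(1) by (simp add: gaussian_elliptic_def)
  obtain i j where e: "e = (i, j)" "i < N" "j < N" using assms(2) by auto
  show ?thesis
  proof (cases "i = j")
    case True
    then show ?thesis
      using assms(1) e centred_gaussian_moments(1) by (auto simp: gaussian_elliptic_def)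
  next
    case False
    from gaussian_elliptic_offdiag[OF assms(1) False e(2,3)] gaussian_pair_moments(1) e(1)
    show ?thesis by blast
  qed
qed

lemma gaussian_elliptic_wick_same:
  assumes E: "gaussian_elliptic M \<gamma> N Y" and e: "e \<in> {..<N} \<times> {..<N}"
    and es: "set es \<subseteq> {e, prod.swap e}"
  defines "y \<equiv> (\<lambda>e \<omega>. Y \<omega> $$ e)"
  shows "integral\<^sup>L M (\<lambda>\<omega>. y e \<omega> * monom_rv y es \<omega>) = integral\<^sup>L M (dmonom_rv (elliptic_cov \<gamma> 1 e) y es)"
proof -
  interpret prob_space M using E by (simp add: gaussian_elliptic_def)
  obtain i j where ij: "e = (i, j)" "i < N" "j < N" using e by auto
  show ?thesis
  proof (cases "i = j")
    case True
    \<comment> \<open>A dummy second position absent from \<open>es\<close>, so that the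
      two-variable formulas apply to a single diagonal variable. It may lie outside the matrix,
      since its exponent is always 0.\<close>
    define e' where "e' = (i, Suc i)"
    have e': "e \<noteq> e'" "set es \<subseteq> {e, e'}" "count_list es e' = 0" "elliptic_cov \<gamma> 1 e e = 1 + \<gamma>"
      using es True ij by (auto simp: e'_def count_list_0_iff elliptic_cov_def)
    have Y: "gaussian_rv M (y e)" "expectation (y e) = 0" "expectation (\<lambda>\<omega>. (y e \<omega>)\<^sup>2) = 1 + \<gamma>"
      using E ij True by (auto simp: gaussian_elliptic_def y_def)
    let ?a = "count_list es e"
    have "expectation (\<lambda>\<omega>. y e \<omega> * monom_rv y es \<omega>) = expectation (\<lambda>\<omega>. y e \<omega> ^ Suc ?a)"
      unfolding monom_rv_two[OF e'(1,2)] e'(3) by simp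
    also have "\<dots> = (1 + \<gamma>) * (real ?a * expectation (\<lambda>\<omega>. y e \<omega> ^ (?a - 1)))"
    proof (cases ?a)
      case (Suc a)
      then show ?thesis using centred_gaussian_moments(2)[OF Y(1,2), of a] unfolding Y(3)
        by (simp only: diff_Suc_1 mult_ac)
    qed (simp add: Y)
    also have "\<dots> = expectation (dmonom_rv (elliptic_cov \<gamma> 1 e) y es)"
      unfolding dmonom_rv_two[OF e'(1,2)] e'(3,4) by simp
    finally show ?thesis .
  next
    case False
    define e' where "e' = prod.swap e"
    have e': "e \<noteq> e'" "set es \<subseteq> {e, e'}" "elliptic_cov \<gamma> 1 e e = 1" "elliptic_cov \<gamma> 1 e e' = \<gamma>"
      using es ij False by (auto simp: e'_def elliptic_cov_def)
    have P: "gaussian_pair M (y e) (y e')" "expectation (y e) = 0" "expectation (y e') = 0"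
      "expectation (\<lambda>\<omega>. (y e \<omega>)\<^sup>2) = 1" "expectation (\<lambda>\<omega>. (y e' \<omega>)\<^sup>2) = 1"
      "expectation (\<lambda>\<omega>. y e \<omega> * y e' \<omega>) = \<gamma>"
      using gaussian_elliptic_offdiag[OF E False ij(2,3)] unfolding y_def e'_def ij(1) by auto
    let ?a = "count_list es e" and ?b = "count_list es e'"
    have "expectation (\<lambda>\<omega>. y e \<omega> * monom_rv y es \<omega>) = expectation (\<lambda>\<omega>. y e \<omega> ^ Suc ?a * y e' \<omega> ^ ?b)"
      unfolding monom_rv_two[OF e'(1,2)] by (simp add: mult.assoc)
    also have "\<dots> = real ?a * expectation (\<lambda>\<omega>. y e \<omega> ^ (?a - 1) * y e' \<omega> ^ ?b)
        + \<gamma> * real ?b * expectation (\<lambda>\<omega>. y e \<omega> ^ ?a * y e' \<omega> ^ (?b - 1))"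
      by (rule gaussian_pair_moments(3)[OF P])
    also have "\<dots> = expectation (dmonom_rv (elliptic_cov \<gamma> 1 e) y es)"
      unfolding dmonom_rv_two[OF e'(1,2)] e'(3,4)
      using finite_moments_integrable_mono[OF gaussian_pair_moments(1,2)[OF P]] by simp
    finally show ?thesis .
  qed
qed

text \<open>The monomial is split into the factors at \<open>e\<close> and
  \<open>prod.swap e\<close> and the others. The others are independent of the first group and of
  the entry at \<open>e\<close>, so they pass through both the expectation and the
  derivation.\<close>

lemma gaussian_elliptic_wick:
  assumes E: "gaussian_elliptic M \<gamma> N Y" and e: "e \<in> {..<N} \<times> {..<N}"
    and es: "set es \<subseteq> {..<N} \<times> {..<N}"
  defines "y \<equiv> (\<lambda>e \<omega>. Y \<omega> $$ e)"
  shows "integral\<^sup>L M (\<lambda>\<omega>. y e \<omega> * monom_rv y es \<omega>) = integral\<^sup>L M (dmonom_rv (elliptic_cov \<gamma> 1 e) y es)"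
proof -
  interpret prob_space M using E by (simp add: gaussian_elliptic_def)
  define I where "I = {(i, j). i \<le> j \<and> j < N}"
  have "indep_vars (\<lambda>_. borel :: (real \<times> real) measure) (\<lambda>(i, j) \<omega>. (Y \<omega> $$ (i, j), Y \<omega> $$ (j, i))) I"
    using E unfolding gaussian_elliptic_def I_def by blast
  also have "(\<lambda>(i, j) \<omega>. (Y \<omega> $$ (i, j), Y \<omega> $$ (j, i))) = (\<lambda>p \<omega>. (y p \<omega>, y (prod.swap p) \<omega>))"
    by (auto simp: fun_eq_iff y_def)
  finally have ind: "indep_vars (\<lambda>_. borel :: (real \<times> real) measure) (\<lambda>p \<omega>. (y p \<omega>, y (prod.swap p) \<omega>)) I" .
  define A where "A = {upper_pos e}"
  define B where "B = I - A"
  have upI: "upper_pos f \<in> I" if "f \<in> {..<N} \<times> {..<N}" for f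
    using that by (auto simp: upper_pos_def I_def)
  have AB: "A \<inter> B = {}" "A \<subseteq> I" "B \<subseteq> I" using upI[OF e] by (auto simp: A_def B_def)
  define P where "P f \<longleftrightarrow> f \<in> {e, prod.swap e}" for f
  have P_iff: "P f \<longleftrightarrow> upper_pos f = upper_pos e" for f
    by (cases e; cases f) (auto simp: P_def upper_pos_def)
  let ?G = "filter P es" and ?H = "filter (\<lambda>f. \<not> P f) es"
  let ?d = "elliptic_cov \<gamma> 1 e"
  have G: "upper_pos ` set ?G \<subseteq> A" "upper_pos ` set (e # ?G) \<subseteq> A" by (auto simp: P_iff A_def)
  have H: "upper_pos ` set ?H \<subseteq> B" using es upI by (auto simp: P_iff B_def A_def)
  have fm: "finite_moments M (y f)" if "f \<in> {..<N} \<times> {..<N}" for f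
    unfolding y_def by (rule gaussian_elliptic_entry_moments[OF E that])
  have mon: "finite_moments M (monom_rv y fs)" if "set fs \<subseteq> {..<N} \<times> {..<N}" for fs
    using that by (induction fs) (auto intro!: finite_moments_const finite_moments_mult fm)
  have dmon: "finite_moments M (dmonom_rv ?d y fs)" if "set fs \<subseteq> {..<N} \<times> {..<N}" for fs
    using that by (induction fs)
      (auto intro!: finite_moments_const finite_moments_add finite_moments_mult fm mon)
  have sub: "set ?G \<subseteq> {..<N} \<times> {..<N}" "set (e # ?G) \<subseteq> {..<N} \<times> {..<N}" "set ?H \<subseteq> {..<N} \<times> {..<N}"
    using e es by auto
  have "expectation (\<lambda>\<omega>. y e \<omega> * monom_rv y es \<omega>)
      = expectation (\<lambda>\<omega>. monom_rv y (e # ?G) \<omega> * monom_rv y ?H \<omega>)"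
    by (subst monom_rv_filter[of y es _ P]) (simp add: mult.assoc)
  also have "\<dots> = expectation (monom_rv y (e # ?G)) * expectation (monom_rv y ?H)"
    by (rule expectation_mult_disjoint[OF ind AB monom_rv_measurable[OF G(2)] monom_rv_measurable[OF H]
          monom_rv_restrict[OF G(2), where y = y, symmetric] monom_rv_restrict[OF H, where y = y, symmetric]])
       (intro finite_moments_integrable mon sub)+
  also have "expectation (monom_rv y (e # ?G)) = expectation (dmonom_rv ?d y ?G)"
    unfolding monom_rv.simps y_def by (rule gaussian_elliptic_wick_same[OF E e]) (auto simp: P_def)
  also have "expectation (dmonom_rv ?d y ?G) * expectation (monom_rv y ?H)
      = expectation (\<lambda>\<omega>. dmonom_rv ?d y ?G \<omega> * monom_rv y ?H \<omega>)"
    by (rule expectation_mult_disjoint[OF ind AB dmonom_rv_measurable[OF G(1)] monom_rv_measurable[OF H]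
          dmonom_rv_restrict[OF G(1), where y = y, symmetric] monom_rv_restrict[OF H, where y = y, symmetric], symmetric])
       (intro finite_moments_integrable mon dmon sub)+
  also have "(\<lambda>\<omega>. dmonom_rv ?d y ?G \<omega> * monom_rv y ?H \<omega>) = dmonom_rv ?d y es"
    by (rule ext, rule dmonom_rv_filter[symmetric]) (auto simp: P_def elliptic_cov_def)
  finally show ?thesis .
qed

lemma gaussian_elliptic_words:
  assumes E: "gaussian_elliptic M \<gamma> N Y" and N: "N \<ge> 1"
  shows "gaussian_words M \<gamma> N (\<lambda>e \<omega>. 1 / sqrt (real N) * Y \<omega> $$ e)"
proof -
  interpret prob_space M using E by (simp add: gaussian_elliptic_def)
  let ?r = "1 / sqrt (real N)"
  have cov: "elliptic_cov \<gamma> (1 / real N) e = (\<lambda>f. ?r\<^sup>2 * elliptic_cov \<gamma> 1 e f)" for e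
    using N by (simp add: fun_eq_iff elliptic_cov_def power_divide)
  show ?thesis
  proof unfold_locales
    show "1 \<le> N" by (rule N)
    fix e assume e: "e \<in> {..<N} \<times> {..<N}"
    show "finite_moments M (\<lambda>\<omega>. ?r * Y \<omega> $$ e)"
      by (intro finite_moments_mult finite_moments_const gaussian_elliptic_entry_moments[OF E e])
    fix es :: "(nat \<times> nat) list" assume es: "set es \<subseteq> {..<N} \<times> {..<N}"
    have "expectation (\<lambda>\<omega>. ?r * Y \<omega> $$ e * monom_rv (\<lambda>e \<omega>. ?r * Y \<omega> $$ e) es \<omega>)
      = expectation (\<lambda>\<omega>. ?r ^ Suc (length es) * (Y \<omega> $$ e * monom_rv (\<lambda>e \<omega>. Y \<omega> $$ e) es \<omega>))"
      unfolding monom_rv_scale by (simp add: mult_ac)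
    also have "\<dots> = ?r ^ Suc (length es) * expectation (dmonom_rv (elliptic_cov \<gamma> 1 e) (\<lambda>e \<omega>. Y \<omega> $$ e) es)"
      unfolding integral_mult_right_zero gaussian_elliptic_wick[OF E e es] ..
    also have "\<dots> = expectation (dmonom_rv (elliptic_cov \<gamma> (1 / real N) e) (\<lambda>e \<omega>. ?r * Y \<omega> $$ e) es)"
      unfolding cov dmonom_rv_scale integral_mult_right_zero ..
    finally show "expectation (\<lambda>\<omega>. ?r * Y \<omega> $$ e * monom_rv (\<lambda>e \<omega>. ?r * Y \<omega> $$ e) es \<omega>)
      = expectation (dmonom_rv (elliptic_cov \<gamma> (1 / real N) e) (\<lambda>e \<omega>. ?r * Y \<omega> $$ e) es)" .
  qed
qed

section \<open>Passage to the limit\<close>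

text \<open>A sum over non-crossing pairings of the letters, each pair weighted by
  \<open>straight_wt\<close>; the twisted pairings carried 1/N and are gone.\<close>

function lim_mean :: "real \<Rightarrow> bool list \<Rightarrow> real" where
  "lim_mean \<gamma> [] = 1"
| "lim_mean \<gamma> (x # w) = (\<Sum>l<length w.
     straight_wt \<gamma> x (w ! l) * (lim_mean \<gamma> (take l w) * lim_mean \<gamma> (drop (Suc l) w)))"
  by pat_completeness auto
termination by (relation "Wellfounded.measure (\<lambda>(\<gamma>, w). length w)") auto

text \<open>A sum over non-crossing pairings in an annulus. The second word stays intact until a
  letter is paired across; then the circles merge and only a mean is left. Hence the first word
  alone controls termination.\<close>

function lim_cov :: "real \<Rightarrow> bool list \<Rightarrow> bool list \<Rightarrow> real" where
  "lim_cov \<gamma> [] v = 0"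
| "lim_cov \<gamma> (x # w) v = (\<Sum>l<length w. straight_wt \<gamma> x (w ! l) *
       (lim_mean \<gamma> (take l w) * lim_cov \<gamma> (drop (Suc l) w) v
      + lim_mean \<gamma> (drop (Suc l) w) * lim_cov \<gamma> (take l w) v))
   + (\<Sum>l<length v. twisted_wt \<gamma> x (v ! l) * lim_mean \<gamma> (w @ word_transpose (cut_at l v))
      + straight_wt \<gamma> x (v ! l) * lim_mean \<gamma> (w @ cut_at l v))"
  by pat_completeness auto
termination by (relation "Wellfounded.measure (\<lambda>(\<gamma>, w, v). length w)") auto

section \<open>Boundedness and limits from the loop equations\<close>

lemma bounded_inverse_Suc: "(\<lambda>n. 1 / real (Suc n)) \<in> O(\<lambda>_. 1 :: real)"
  by (intro bigoI[of _ 1] always_eventually allI) (simp add: divide_le_eq)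

lemma bounded_divide_Suc:
  "f \<in> O(\<lambda>_. 1 :: real) \<Longrightarrow> (\<lambda>n. f n / real (Suc n)) \<in> O(\<lambda>_. 1 :: real)"
  using landau_o.big.mult_in_1[OF _ bounded_inverse_Suc, of f] by simp

lemma tendsto_divide_Suc:
  assumes "f \<in> O(\<lambda>_. 1 :: real)"
  shows "(\<lambda>n. f n / real (Suc n)) \<longlonglongrightarrow> 0"
proof -
  obtain c where c: "eventually (\<lambda>n. norm (f n) \<le> c) sequentially"
    using assms by (auto elim: landau_o.bigE)
  have "(\<lambda>n. c * (1 / real (Suc n))) \<longlonglongrightarrow> c * 0"
    by (intro tendsto_intros) (use LIMSEQ_inverse_real_of_nat in \<open>simp add: inverse_eq_divide\<close>)
  then have lim: "(\<lambda>n. c / real (Suc n)) \<longlonglongrightarrow> 0" by simp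
  have "eventually (\<lambda>n. norm (f n / real (Suc n)) \<le> c / real (Suc n)) sequentially"
    using c by eventually_elim (simp add: divide_right_mono)
  then show ?thesis by (rule Lim_null_comparison[OF _ lim])
qed

abbreviation "total_length vs \<equiv> sum_list (map length (vs :: bool list list))"

lemma length_word_transpose [simp]: "length (word_transpose w) = length w"
  by (simp add: word_transpose_def)

lemma length_cut_at: "l < length v \<Longrightarrow> length (cut_at l v) = length v - 1"
  by (simp add: cut_at_def)

lemma total_length_skip_nth:
  "j < length vs \<Longrightarrow> total_length (skip_nth j vs) + length (vs ! j) = total_length vs"
  by (subst (2) id_take_nth_drop[of j vs]) (simp_all add: skip_nth_def)

text \<open>The recursions alone, free of probability: \<open>m\<close> is the normalized mean and
  \<open>J\<close> the centred moment. The index \<open>n\<close> stands for the matrix size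
  \<open>Suc n\<close>, which excludes division by zero.\<close>

locale loop_equations =
  fixes \<gamma> :: real and m :: "nat \<Rightarrow> bool list \<Rightarrow> real" and J :: "nat \<Rightarrow> bool list list \<Rightarrow> real"
  assumes m_Nil: "m n [] = 1"
    and J_Nil: "J n [] = 1"
    and J_Nil_Cons: "J n ([] # vs) = 0"
    and m_Cons: "m n (x # w) =
    (\<Sum>l<length w. straight_wt \<gamma> x (w ! l) * (J n [take l w, drop (Suc l) w] / real (Suc n) / real (Suc n)
         + m n (take l w) * m n (drop (Suc l) w))
     + twisted_wt \<gamma> x (w ! l) * (m n (word_transpose (take l w) @ drop (Suc l) w) / real (Suc n)))"
    and J_Cons: "J n ((x # w) # vs) =
    (\<Sum>l<length w.
       straight_wt \<gamma> x (w ! l) * ((J n (take l w # drop (Suc l) w # vs)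
            - J n [take l w, drop (Suc l) w] * J n vs) / real (Suc n)
         + m n (take l w) * J n (drop (Suc l) w # vs)
         + m n (drop (Suc l) w) * J n (take l w # vs))
     + twisted_wt \<gamma> x (w ! l) * (J n ((word_transpose (take l w) @ drop (Suc l) w) # vs) / real (Suc n)))
    + (\<Sum>j<length vs. \<Sum>l<length (vs ! j).
     twisted_wt \<gamma> x (vs ! j ! l) *
       (J n ((w @ word_transpose (cut_at l (vs ! j))) # skip_nth j vs) / real (Suc n)
      + m n (w @ word_transpose (cut_at l (vs ! j))) * J n (skip_nth j vs))
   + straight_wt \<gamma> x (vs ! j ! l) *
       (J n ((w @ cut_at l (vs ! j)) # skip_nth j vs) / real (Suc n)
      + m n (w @ cut_at l (vs ! j)) * J n (skip_nth j vs)))"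
begin

text \<open>Both bounds are proved together, since means involve covariances and centred moments
  involve means of merged words. Splitting can increase the number of words, but each pairing
  consumes two letters, so the total length is the right measure.\<close>

lemma bounded:
  "(\<forall>w. length w \<le> k \<longrightarrow> (\<lambda>n. m n w) \<in> O(\<lambda>_. 1)) \<and>
   (\<forall>vs. total_length vs \<le> k \<longrightarrow> (\<lambda>n. J n vs) \<in> O(\<lambda>_. 1))"
proof (induction k rule: less_induct)
  case (less k)
  have IHm: "(\<lambda>n. m n w) \<in> O(\<lambda>_. 1)" if "length w < k" for w
    using less[OF that] by blast
  have IHJ: "(\<lambda>n. J n vs) \<in> O(\<lambda>_. 1)" if "total_length vs < k" for vs
    using less[OF that] by blast
  note rules = sum_in_bigo landau_o.big.mult_in_1 big_sum_in_bigo bounded_divide_Suc bigo_const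
  show ?case
  proof (intro conjI allI impI)
    fix w :: "bool list" assume len: "length w \<le> k"
    show "(\<lambda>n. m n w) \<in> O(\<lambda>_. 1)"
    proof (cases w)
      case (Cons x u)
      show ?thesis
        unfolding Cons m_Cons
        by (intro rules IHm IHJ) (use len in \<open>auto simp: Cons\<close>)
    qed (simp add: m_Nil)
  next
    fix vs assume len: "total_length vs \<le> k"
    show "(\<lambda>n. J n vs) \<in> O(\<lambda>_. 1)"
    proof (cases vs)
      case vs: (Cons v us)
      show ?thesis
      proof (cases v)
        case (Cons x w)
        have aux: "total_length (skip_nth j us) + length w + length (us ! j) < k" if "j < length us" for j
          using total_length_skip_nth[OF that] len by (simp add: vs Cons)
        show ?thesis
          unfolding vs Cons J_Cons
          by (intro rules IHm IHJ)
             (use len in \<open>auto simp: vs Cons length_cut_at dest!: aux\<close>)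
      qed (simp add: vs J_Nil_Cons)
    qed (simp add: J_Nil)
  qed
qed

lemma bounded_m: "(\<lambda>n. m n w) \<in> O(\<lambda>_. 1)"
  using bounded[of "length w"] by blast

lemma bounded_J: "(\<lambda>n. J n vs) \<in> O(\<lambda>_. 1)"
  using bounded[of "total_length vs"] by blast

lemma m_tendsto: "(\<lambda>n. m n w) \<longlonglongrightarrow> lim_mean \<gamma> w"
proof (induction w rule: length_induct)
  case (1 w)
  show ?case
  proof (cases w)
    case (Cons x u)
    have "(\<lambda>n. m n w) \<longlonglongrightarrow> (\<Sum>l<length u. straight_wt \<gamma> x (u ! l) *
        (0 + lim_mean \<gamma> (take l u) * lim_mean \<gamma> (drop (Suc l) u)) + twisted_wt \<gamma> x (u ! l) * 0)"
      unfolding Cons m_Cons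
      by (intro tendsto_sum tendsto_add tendsto_mult tendsto_const tendsto_divide_Suc bounded_divide_Suc
          bounded_m bounded_J 1[rule_format]) (auto simp: Cons)
    then show ?thesis by (simp add: Cons)
  qed (simp add: m_Nil)
qed

text \<open>The equation for two words contains moments of three words and of one merged word, all
  divided by N; boundedness is enough to dispose of them.\<close>

lemma J_tendsto: "(\<lambda>n. J n [w, v]) \<longlonglongrightarrow> lim_cov \<gamma> w v"
proof (induction w rule: length_induct)
  case (1 w)
  show ?case
  proof (cases w)
    case (Cons x u)
    have J: "J n [x # u, v] = (\<Sum>l<length u.
       straight_wt \<gamma> x (u ! l) * ((J n [take l u, drop (Suc l) u, v]
            - J n [take l u, drop (Suc l) u] * J n [v]) / real (Suc n)
         + m n (take l u) * J n [drop (Suc l) u, v]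
         + m n (drop (Suc l) u) * J n [take l u, v])
     + twisted_wt \<gamma> x (u ! l) * (J n [word_transpose (take l u) @ drop (Suc l) u, v] / real (Suc n)))
    + (\<Sum>l<length v. twisted_wt \<gamma> x (v ! l) *
       (J n [u @ word_transpose (cut_at l v)] / real (Suc n) + m n (u @ word_transpose (cut_at l v)) * 1)
   + straight_wt \<gamma> x (v ! l) *
       (J n [u @ cut_at l v] / real (Suc n) + m n (u @ cut_at l v) * 1))" for n
      by (simp add: J_Cons skip_nth_def J_Nil)
    have "(\<lambda>n. J n [w, v]) \<longlonglongrightarrow> (\<Sum>l<length u. straight_wt \<gamma> x (u ! l) *
        (0 + lim_mean \<gamma> (take l u) * lim_cov \<gamma> (drop (Suc l) u) v
           + lim_mean \<gamma> (drop (Suc l) u) * lim_cov \<gamma> (take l u) v) + twisted_wt \<gamma> x (u ! l) * 0)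
     + (\<Sum>l<length v. twisted_wt \<gamma> x (v ! l) * (0 + lim_mean \<gamma> (u @ word_transpose (cut_at l v)) * 1)
      + straight_wt \<gamma> x (v ! l) * (0 + lim_mean \<gamma> (u @ cut_at l v) * 1))"
      unfolding Cons J
      by (intro tendsto_sum tendsto_add tendsto_mult tendsto_const tendsto_divide_Suc sum_in_bigo
          landau_o.big.mult_in_1 bounded_m bounded_J m_tendsto 1[rule_format]) (auto simp: Cons)
    then show ?thesis by (simp add: Cons)
  qed (simp add: J_Nil_Cons)
qed

end

section \<open>Ballot and central binomial generating functions\<close>

text \<open>For n = 2m this is g^m times the m-th Catalan number: non-crossing pairings of n points
  with weight g per pair.\<close>

function catalan_wt :: "real \<Rightarrow> nat \<Rightarrow> real" where
  "catalan_wt g 0 = 1"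
| "catalan_wt g (Suc 0) = 0"
| "catalan_wt g (Suc (Suc n)) = g * (\<Sum>i\<le>n. catalan_wt g i * catalan_wt g (n - i))"
  by pat_completeness auto
termination by (relation "Wellfounded.measure snd") auto

definition catalan_fps :: "real \<Rightarrow> real fps" where
  "catalan_fps g = Abs_fps (catalan_wt g)"

text \<open>Non-crossing partial pairings: k points stay open, enclosed by no pair, and separate k +
  1 stretches that are paired within themselves.\<close>

definition ballot_fps :: "real \<Rightarrow> nat \<Rightarrow> real fps" where
  "ballot_fps g k = fps_X ^ k * catalan_fps g ^ Suc k"

text \<open>The denominator is the square root of 1 - 4 g z^2, written through c. The coefficients
  count walks with steps +1 and -1 from 0 to \<open>a\<close>, each down step weighted by g.\<close>

definition cbin_fps :: "real \<Rightarrow> nat \<Rightarrow> real fps" where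
  "cbin_fps g a = (fps_X * catalan_fps g) ^ a
     * inverse (1 - 2 * fps_const g * fps_X * (fps_X * catalan_fps g))"

definition ballot_wt :: "real \<Rightarrow> nat \<Rightarrow> nat \<Rightarrow> real" where
  "ballot_wt g n k = fps_nth (ballot_fps g k) n"

definition cbin_wt :: "real \<Rightarrow> nat \<Rightarrow> nat \<Rightarrow> real" where
  "cbin_wt g n a = fps_nth (cbin_fps g a) n"

lemma catalan_fps_eq:
  "catalan_fps g = 1 + fps_const g * (fps_X * (fps_X * (catalan_fps g * catalan_fps g)))"
proof (rule fps_ext)
  fix n
  show "fps_nth (catalan_fps g) n =
    fps_nth (1 + fps_const g * (fps_X * (fps_X * (catalan_fps g * catalan_fps g)))) n"
    by (cases "(g, n)" rule: catalan_wt.cases)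
       (auto simp: catalan_fps_def fps_mult_nth[of "Abs_fps _"] atLeast0AtMost)
qed

lemma catalan_wt_odd: "odd n \<Longrightarrow> catalan_wt g n = 0"
proof (induction g n rule: catalan_wt.induct)
  case (3 g n)
  have "catalan_wt g i * catalan_wt g (n - i) = 0" if "i \<le> n" for i
    using 3 that by (cases "odd i") auto
  then have "(\<Sum>i\<le>n. catalan_wt g i * catalan_wt g (n - i)) = 0"
    by (intro sum.neutral) blast
  then show ?case by simp
qed auto

lemma ballot_fps_0: "ballot_fps g 0 = catalan_fps g"
  by (simp add: ballot_fps_def)

lemma ballot_fps_Suc: "ballot_fps g (Suc k) = fps_X * (catalan_fps g * ballot_fps g k)"
  by (simp add: ballot_fps_def algebra_simps)

text \<open>Decomposition by the first point: it is open, or it is paired and cuts off one closed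
  stretch. Algebraically, the equation for c is applied to one of the k + 1 factors.\<close>

lemma ballot_fps_first:
  "ballot_fps g k = (if k = 0 then 1 else fps_X * ballot_fps g (k - 1))
     + fps_const g * (fps_X * (fps_X * (catalan_fps g * ballot_fps g k)))"
proof -
  define c where "c = catalan_fps g"
  have c: "c = 1 + fps_const g * (fps_X * (fps_X * (c * c)))"
    unfolding c_def by (rule catalan_fps_eq)
  have "ballot_fps g k = fps_X ^ k * c ^ k * c" by (simp add: ballot_fps_def c_def)
  also have "\<dots> = fps_X ^ k * c ^ k * (1 + fps_const g * (fps_X * (fps_X * (c * c))))"
    by (simp only: c[symmetric])
  also have "\<dots> = fps_X ^ k * c ^ k + fps_const g * (fps_X * (fps_X * (c * ballot_fps g k)))"
    by (simp add: ballot_fps_def c_def algebra_simps)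
  also have "fps_X ^ k * c ^ k = (if k = 0 then 1 else fps_X * ballot_fps g (k - 1))"
    by (cases k) (auto simp: ballot_fps_def c_def algebra_simps)
  finally show ?thesis by (simp add: c_def)
qed

lemma fps_X_X_mult_nth_Suc:
  "fps_nth (fps_const g * (fps_X * (fps_X * (f * h)))) (Suc n)
     = g * (\<Sum>i<n. fps_nth f i * fps_nth h (n - 1 - i))" for g :: real
proof (cases n)
  case (Suc m)
  then show ?thesis
    by (simp add: fps_mult_nth[of f] atLeast0AtMost lessThan_Suc_atMost)
qed simp

lemma ballot_wt_0: "ballot_wt g n 0 = catalan_wt g n"
  by (simp add: ballot_wt_def ballot_fps_0 catalan_fps_def)

lemma ballot_wt_at_0: "ballot_wt g 0 k = (if k = 0 then 1 else 0)"
  by (simp add: ballot_wt_def ballot_fps_def catalan_fps_def fps_mult_nth)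

text \<open>Decomposition by the first open point, which is preceded by a closed stretch of
  \<open>j\<close> points.\<close>

lemma ballot_wt_Suc_Suc:
  "ballot_wt g l (Suc k) = (\<Sum>j<l. catalan_wt g j * ballot_wt g (l - 1 - j) k)"
proof (cases l)
  case (Suc m)
  then show ?thesis
    by (simp add: ballot_wt_def ballot_fps_Suc catalan_fps_def fps_mult_nth[of "Abs_fps _"] atLeast0AtMost lessThan_Suc_atMost)
qed (simp add: ballot_wt_at_0)

lemma ballot_wt_first:
  "ballot_wt g (Suc n) k = (if k = 0 then 0 else ballot_wt g n (k - 1))
     + g * (\<Sum>i<n. catalan_wt g i * ballot_wt g (n - 1 - i) k)"
proof -
  have "ballot_wt g (Suc n) k = fps_nth (if k = 0 then 1 else fps_X * ballot_fps g (k - 1)) (Suc n)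
     + fps_nth (fps_const g * (fps_X * (fps_X * (catalan_fps g * ballot_fps g k)))) (Suc n)"
    unfolding ballot_wt_def by (subst ballot_fps_first) (rule fps_add_nth)
  then show ?thesis
    unfolding fps_X_X_mult_nth_Suc by (simp add: ballot_wt_def catalan_fps_def)
qed

lemma ballot_wt_eq_0: "n < k \<Longrightarrow> ballot_wt g n k = 0"
  by (simp add: ballot_wt_def ballot_fps_def fps_X_power_mult_nth)

section \<open>Central binomial weights and their relation to ballot numbers\<close>

lemma cbin_fps_mult:
  "cbin_fps g a * (1 - 2 * fps_const g * fps_X * (fps_X * catalan_fps g)) = (fps_X * catalan_fps g) ^ a"
proof -
  have "fps_nth (1 - 2 * fps_const g * fps_X * (fps_X * catalan_fps g)) 0 \<noteq> 0"
    by (simp add: fps_mult_nth)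
  then show ?thesis
    unfolding cbin_fps_def mult.assoc using inverse_mult_eq_1 by (metis mult.right_neutral)
qed

lemma cbin_denom_nonzero: "1 - 2 * fps_const g * fps_X * (fps_X * catalan_fps g) \<noteq> 0"
proof
  assume "1 - 2 * fps_const g * fps_X * (fps_X * catalan_fps g) = 0"
  then have "fps_nth (1 - 2 * fps_const g * fps_X * (fps_X * catalan_fps g)) 0 = 0" by simp
  then show False by (simp add: fps_mult_nth)
qed

lemma cbin_fps_eqI:
  "f * (1 - 2 * fps_const g * fps_X * (fps_X * catalan_fps g)) = (fps_X * catalan_fps g) ^ a
    \<Longrightarrow> cbin_fps g a = f"
  using cbin_fps_mult[of g a] cbin_denom_nonzero[of g] by (metis mult_right_cancel)

text \<open>For u = z c this reads u = z (1 + g u^2), the fixed-point form behind the recursion in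
  \<open>a\<close> and the derivative of u.\<close>

lemma X_catalan_eq:
  "fps_X * (1 + fps_const g * (fps_X * catalan_fps g) ^ 2) = fps_X * catalan_fps g"
proof -
  have "fps_X * catalan_fps g = fps_X * (1 + fps_const g * (fps_X * (fps_X * (catalan_fps g * catalan_fps g))))"
    by (rule arg_cong[OF catalan_fps_eq])
  also have "\<dots> = fps_X * (1 + fps_const g * (fps_X * catalan_fps g) ^ 2)"
    by (simp add: algebra_simps power2_eq_square)
  finally show ?thesis ..
qed

lemma cbin_fps_0: "cbin_fps g 0 = 1 + fps_const (2 * g) * (fps_X * cbin_fps g 1)"
proof (rule cbin_fps_eqI)
  have two: "fps_const (2 * g) = 2 * fps_const g"
    by (metis fps_const_mult fps_numeral_fps_const)
  have "(1 + fps_const (2 * g) * (fps_X * cbin_fps g 1)) * (1 - 2 * fps_const g * fps_X * (fps_X * catalan_fps g))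
    = (1 - 2 * fps_const g * fps_X * (fps_X * catalan_fps g)) + 2 * fps_const g * fps_X *
      (cbin_fps g 1 * (1 - 2 * fps_const g * fps_X * (fps_X * catalan_fps g)))"
    unfolding two by (simp only: algebra_simps mult_1 mult_1_right)
  then show "(1 + fps_const (2 * g) * (fps_X * cbin_fps g 1)) * (1 - 2 * fps_const g * fps_X * (fps_X * catalan_fps g))
     = (fps_X * catalan_fps g) ^ 0"
    unfolding cbin_fps_mult by simp
qed

text \<open>Multiplied by the denominator this is u^(a+1) = z (u^a + g u^(a+2)): the last step of a
  walk to a + 1 comes from a or from a + 2.\<close>

lemma cbin_fps_Suc:
  "cbin_fps g (Suc a) = fps_X * (cbin_fps g a + fps_const g * cbin_fps g (Suc (Suc a)))"
proof (rule cbin_fps_eqI)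
  let ?D = "1 - 2 * fps_const g * fps_X * (fps_X * catalan_fps g)"
  let ?u = "fps_X * catalan_fps g"
  have "fps_X * (cbin_fps g a + fps_const g * cbin_fps g (Suc (Suc a))) * ?D
    = fps_X * (cbin_fps g a * ?D + fps_const g * (cbin_fps g (Suc (Suc a)) * ?D))"
    by (simp only: algebra_simps)
  also have "\<dots> = ?u ^ a * (fps_X * (1 + fps_const g * ?u ^ 2))"
    unfolding cbin_fps_mult by (simp only: algebra_simps power_Suc power2_eq_square mult_1 mult_1_right)
  also have "\<dots> = ?u ^ Suc a" unfolding X_catalan_eq by (simp add: algebra_simps)
  finally show "fps_X * (cbin_fps g a + fps_const g * cbin_fps g (Suc (Suc a))) * ?D = ?u ^ Suc a" .
qed

lemma cbin_wt_at_0: "cbin_wt g 0 a = (if a = 0 then 1 else 0)"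
proof (cases a)
  case (Suc b)
  then show ?thesis unfolding cbin_wt_def Suc by (subst cbin_fps_Suc) simp
qed (simp add: cbin_wt_def cbin_fps_0)

lemma cbin_wt_closed:
  "cbin_wt g n a = (if a \<le> n \<and> even (n - a)
     then g ^ ((n - a) div 2) * real (n choose ((n - a) div 2)) else 0)"
proof (induction n arbitrary: a)
  case 0
  then show ?case by (simp add: cbin_wt_at_0)
next
  case (Suc n)
  show ?case
  proof (cases a)
    case 0
    have rec: "cbin_wt g (Suc n) 0 = 2 * g * cbin_wt g n 1"
      by (simp add: cbin_wt_def cbin_fps_0)
    show ?thesis
    proof (cases "even (Suc n)")
      case True
      \<comment> \<open>The central coefficient binom(2m+2, m+1) is twice binom(2m+1, m), which
        matches the factor 2 in the recursion at \<open>a = 0\<close>.\<close>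
      then obtain m where m: "n = 2 * m + 1"
        by (metis oddE even_Suc)
      have "real (Suc n choose (Suc m)) = 2 * real (n choose m)"
        unfolding m using binomial_symmetric[of "Suc m" "2 * m + 1"] by simp
      then show ?thesis
        unfolding 0 rec Suc.IH unfolding m by simp
    next
      case False
      then show ?thesis unfolding 0 rec Suc.IH by auto
    qed
  next
    case (Suc b)
    have rec: "cbin_wt g (Suc n) (Suc b) = cbin_wt g n b + g * cbin_wt g n (Suc (Suc b))"
      unfolding cbin_wt_def by (subst cbin_fps_Suc) simp
    show ?thesis
    proof (cases "b \<le> n \<and> even (n - b)")
      case True
      then obtain m where "n - b = 2 * m" by (metis evenE)
      with True have m: "n = b + 2 * m" by simp
      show ?thesis
      proof (cases m)
        case 0
        then show ?thesis using m unfolding Suc rec Suc.IH by simp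
      next
        case m': (Suc m')
        have "n - Suc (Suc b) = 2 * m'" using m m' by simp
        moreover have "Suc (Suc b) \<le> n" using m m' by simp
        moreover have "n - b = 2 * Suc m'" using m m' by simp
        ultimately show ?thesis unfolding Suc rec Suc.IH using True
          by (simp add: algebra_simps)
      qed
    next
      case False
      then have "\<not> (Suc (Suc b) \<le> n \<and> even (n - Suc (Suc b)))"
        by auto
      then show ?thesis unfolding Suc rec Suc.IH using False by auto
    qed
  qed
qed

text \<open>The defining quotient cleared of its denominator; the numerator is z times
  \<open>ballot_fps g k\<close>. It is the covariance recursion seen from one circle: the first
  letter crosses to the other circle, or its pair leaves all crossing letters on one of its two
  sides, whence 2g.\<close>

lemma cbin_wt_rec:
  "cbin_wt g (Suc n) (Suc k) = ballot_wt g n k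
     + 2 * g * (\<Sum>i<n. catalan_wt g i * cbin_wt g (n - 1 - i) (Suc k))"
proof -
  let ?B = "cbin_fps g (Suc k)"
  have two: "fps_const (2 * g) = 2 * fps_const g"
    by (metis fps_const_mult fps_numeral_fps_const)
  have "?B = fps_X * ballot_fps g k + fps_const (2 * g) * (fps_X * (fps_X * (catalan_fps g * ?B)))"
    using cbin_fps_mult[of g "Suc k"] unfolding two ballot_fps_def
    by (simp add: algebra_simps power_mult_distrib)
  then have "cbin_wt g (Suc n) (Suc k) = fps_nth (fps_X * ballot_fps g k) (Suc n)
     + fps_nth (fps_const (2 * g) * (fps_X * (fps_X * (catalan_fps g * ?B)))) (Suc n)"
    unfolding cbin_wt_def by (metis fps_add_nth)
  then show ?thesis
    unfolding fps_X_X_mult_nth_Suc by (simp add: cbin_wt_def ballot_wt_def catalan_fps_def)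
qed

text \<open>Double counting on a circle of q letters: opening it at one of q letters, taken as a
  crossing letter, against marking one of k + 1 crossing letters. Analytically z u' = u / (1 - 2 g z
  u), so z times the derivative of u^(k+1), which is z \<open>ballot_fps g k\<close>, equals (k+1)
  \<open>cbin_fps g (Suc k)\<close>.\<close>

lemma ballot_wt_cbin_wt:
  assumes "q \<ge> 1"
  shows "real q * ballot_wt g (q - 1) k = real (Suc k) * cbin_wt g q (Suc k)"
proof -
  define u where "u = fps_X * catalan_fps g"
  define G where "G = fps_const g"
  have u: "u = fps_X * (1 + G * (u * u))"
    unfolding u_def G_def by (simp only: X_catalan_eq flip: power2_eq_square)
  have dG: "fps_deriv G = 0" by (simp add: G_def)
  have "fps_deriv u = fps_deriv (fps_X * (1 + G * (u * u)))" by (simp only: u[symmetric])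
  then have du: "fps_deriv u = (1 + G * (u * u)) + fps_X * (G * (fps_deriv u * u + u * fps_deriv u))"
    using dG by (simp add: algebra_simps)
  have "fps_X * fps_deriv u = fps_X * (1 + G * (u * u)) + 2 * G * fps_X * u * (fps_X * fps_deriv u)"
    by (subst du) (simp only: algebra_simps mult_2 mult_2_right mult_1)
  then have "fps_X * fps_deriv u = u + 2 * G * fps_X * u * (fps_X * fps_deriv u)"
    by (simp only: u[symmetric])
  then have "fps_X * fps_deriv u - 2 * G * fps_X * u * (fps_X * fps_deriv u) = u"
    by (metis add_diff_cancel_right')
  then have Xdu: "fps_X * fps_deriv u * (1 - 2 * G * fps_X * u) = u"
    by (simp only: right_diff_distrib mult_1 mult_1_right mult.commute)
  have "cbin_fps g (Suc k) = u ^ k * (fps_X * fps_deriv u)"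
  proof (rule cbin_fps_eqI)
    have "u ^ k * (fps_X * fps_deriv u) * (1 - 2 * G * fps_X * u) = u ^ k * (fps_X * fps_deriv u * (1 - 2 * G * fps_X * u))"
      by (simp only: mult.assoc)
    also have "\<dots> = u ^ Suc k" by (simp only: Xdu power_Suc2)
    finally show "u ^ k * (fps_X * fps_deriv u) * (1 - 2 * fps_const g * fps_X * (fps_X * catalan_fps g))
        = (fps_X * catalan_fps g) ^ Suc k"
      unfolding u_def G_def .
  qed
  moreover have "fps_X * fps_deriv (u ^ Suc k) = of_nat (Suc k) * (u ^ k * (fps_X * fps_deriv u))"
    by (subst fps_deriv_power) (simp add: mult_ac fps_of_nat del: of_nat_Suc)
  ultimately have *: "of_nat (Suc k) * cbin_fps g (Suc k) = fps_X * fps_deriv (fps_X * ballot_fps g k)"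
    by (simp add: u_def ballot_fps_def power_mult_distrib algebra_simps)
  obtain n where q: "q = Suc n" using assms by (cases q) auto
  have "fps_nth (of_nat (Suc k) * cbin_fps g (Suc k)) q = real q * ballot_wt g n k"
    unfolding * q by (simp add: ballot_wt_def fps_deriv_nth algebra_simps)
  moreover have "fps_nth (of_nat (Suc k) * cbin_fps g (Suc k)) q = real (Suc k) * cbin_wt g q (Suc k)"
    by (simp add: cbin_wt_def flip: fps_of_nat)
  ultimately show ?thesis by (simp add: q)
qed

section \<open>Periodic words\<close>

primrec periodic_word :: "(bool \<Rightarrow> bool) \<Rightarrow> bool \<Rightarrow> nat \<Rightarrow> bool list" where
  "periodic_word h b 0 = []"
| "periodic_word h b (Suc n) = b # periodic_word h (h b) n"

lemma length_periodic_word [simp]: "length (periodic_word h b n) = n"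
  by (induction n arbitrary: b) auto

lemma nth_periodic_word: "l < n \<Longrightarrow> periodic_word h b n ! l = (h ^^ l) b"
proof (induction n arbitrary: b l)
  case (Suc n)
  then show ?case by (cases l) (simp_all add: funpow_swap1)
qed simp

lemma take_periodic_word: "l \<le> n \<Longrightarrow> take l (periodic_word h b n) = periodic_word h b l"
proof (induction n arbitrary: b l)
  case (Suc n)
  then show ?case by (cases l) simp_all
qed simp

lemma drop_periodic_word: "drop l (periodic_word h b n) = periodic_word h ((h ^^ l) b) (n - l)"
proof (induction n arbitrary: b l)
  case (Suc n)
  then show ?case by (cases l) (simp_all add: funpow_swap1)
qed simp

lemma periodic_word_add: "periodic_word h b (m + n) = periodic_word h b m @ periodic_word h ((h ^^ m) b) n"
  by (induction m arbitrary: b) (simp_all add: funpow_swap1)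

lemma sum_lessThan_add: "(\<Sum>i<m + n. f i) = (\<Sum>i<m. f i) + (\<Sum>i<n. f (m + i))" for f :: "nat \<Rightarrow> real"
  by (induction n) simp_all

text \<open>One treatment for constant words (\<open>id\<close>) and alternating words
  (\<open>Not\<close>); g is the straight weight of two neighbouring letters.\<close>

locale periodic_letters =
  fixes h :: "bool \<Rightarrow> bool" and \<gamma> g :: real
  assumes h_cases: "h = id \<and> g = \<gamma> \<or> h = Not \<and> g = 1"
begin

lemma h_h [simp]: "h (h b) = b"
  using h_cases by auto

lemma funpow_h: "(h ^^ l) b = (if even l then b else h b)"
  by (induction l arbitrary: b) auto

lemma funpow_h_trivial: "(\<forall>b. h b = b) \<or> even n \<Longrightarrow> (h ^^ n) b = b"
  by (metis funpow_h)

lemma straight_wt_h: "straight_wt \<gamma> b (h b) = g"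
  using h_cases by (auto simp: straight_wt_def)

lemma straight_wt_h_h [simp]: "straight_wt \<gamma> (h b) (h d) = straight_wt \<gamma> b d"
  using h_cases by (auto simp: straight_wt_def)

lemma h_Not: "h (\<not> b) = (\<not> h b)"
  using h_cases by auto

lemma rev_periodic_word: "rev (periodic_word h b n) = periodic_word h ((h ^^ (n - 1)) b) n"
proof (rule nth_equalityI)
  fix i assume "i < length (rev (periodic_word h b n))"
  then have i: "i < n" by simp
  then have "even (n - Suc i) \<longleftrightarrow> (even i \<longleftrightarrow> even (n - 1))"
    by (cases n) auto
  with i show "rev (periodic_word h b n) ! i = periodic_word h ((h ^^ (n - 1)) b) n ! i"
    by (auto simp: rev_nth nth_periodic_word funpow_h)
qed simp

lemma map_Not_periodic_word: "map Not (periodic_word h b n) = periodic_word h (\<not> b) n"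
  by (induction n arbitrary: b) (simp_all add: h_Not)

text \<open>A pair enclosing an odd number of letters contributes nothing; one enclosing an even
  number joins letters related by \<open>h\<close>, with weight g. This leaves the recursion of
  \<open>catalan_wt\<close>.\<close>

lemma lim_mean_periodic_word: "lim_mean \<gamma> (periodic_word h b n) = catalan_wt g n"
proof (induction n arbitrary: b rule: less_induct)
  case (less n)
  show ?case
  proof (cases n)
    case (Suc n')
    have "lim_mean \<gamma> (periodic_word h b n) = (\<Sum>l<n'. g * (catalan_wt g l * catalan_wt g (n' - Suc l)))"
      unfolding Suc periodic_word.simps lim_mean.simps length_periodic_word
    proof (rule sum.cong[OF refl])
      fix l assume "l \<in> {..<n'}"
      then have l: "l < n'" by simp
      show "straight_wt \<gamma> b (periodic_word h (h b) n' ! l) *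
        (lim_mean \<gamma> (take l (periodic_word h (h b) n')) * lim_mean \<gamma> (drop (Suc l) (periodic_word h (h b) n')))
        = g * (catalan_wt g l * catalan_wt g (n' - Suc l))"
        using l by (cases "even l")
          (simp_all add: take_periodic_word drop_periodic_word nth_periodic_word less Suc funpow_h
            straight_wt_h catalan_wt_odd del: funpow.simps)
    qed
    also have "\<dots> = catalan_wt g n"
    proof (cases n')
      case m: (Suc n'')
      show ?thesis by (simp add: Suc m sum_distrib_left lessThan_Suc_atMost del: sum.lessThan_Suc)
    qed (simp add: Suc)
    finally show ?thesis .
  qed simp
qed

lemma lim_mean_rev_periodic_word: "lim_mean \<gamma> (rev (periodic_word h b n)) = catalan_wt g n"
  by (simp add: rev_periodic_word lim_mean_periodic_word)

text \<open>The summation index \<open>k\<close> counts the pairs of letters that connect the two halves of the word.\<close>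

lemma lim_mean_two_periodic:
  assumes "n < L"
  shows "lim_mean \<gamma> (periodic_word h b n @ rev (periodic_word h d l))
    = (\<Sum>k<L. straight_wt \<gamma> b d ^ k * (ballot_wt g n k * ballot_wt g l k))"
  using assms
proof (induction "n + l" arbitrary: n l b d rule: less_induct)
  case less
  define t where "t = straight_wt \<gamma> b d"
  show ?case
  proof (cases n)
    case 0
    have "(\<Sum>k<L. t ^ k * (ballot_wt g n k * ballot_wt g l k)) = (\<Sum>k<L. if k = 0 then ballot_wt g l 0 else 0)"
      by (intro sum.cong refl) (simp add: 0 ballot_wt_at_0)
    also have "\<dots> = catalan_wt g l"
      using less.prems by (simp add: ballot_wt_0)
    finally show ?thesis by (simp add: 0 t_def lim_mean_rev_periodic_word)
  next
    case (Suc m)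
    let ?w = "periodic_word h (h b) m @ rev (periodic_word h d l)"
    let ?f = "\<lambda>i. straight_wt \<gamma> b (?w ! i) * (lim_mean \<gamma> (take i ?w) * lim_mean \<gamma> (drop (Suc i) ?w))"
    \<comment> \<open>The first letter pairs inside its own block: a closed stretch of
      \<open>i\<close> letters splits off and the rest is again a two-block word. Odd
      \<open>i\<close> gives zero.\<close>
    have first: "?f i = g * (catalan_wt g i * (\<Sum>k<L. t ^ k * (ballot_wt g (m - 1 - i) k * ballot_wt g l k)))"
      if "i < m" for i
    proof (cases "even i")
      case True
      have "lim_mean \<gamma> (periodic_word h b (m - Suc i) @ rev (periodic_word h d l))
        = (\<Sum>k<L. t ^ k * (ballot_wt g (m - Suc i) k * ballot_wt g l k))"
        unfolding t_def by (rule less.hyps) (use less.prems Suc in auto)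
      then show ?thesis
        using that True
        by (simp add: nth_append take_periodic_word drop_periodic_word nth_periodic_word funpow_h
            straight_wt_h lim_mean_periodic_word del: funpow.simps)
    next
      case False
      then show ?thesis
        using that by (simp add: take_periodic_word lim_mean_periodic_word catalan_wt_odd)
    qed
    \<comment> \<open>The first letter pairs across the blocks with weight t, and the
      \<open>j\<close> outer letters of the second block form a closed stretch. The inner word has
      two blocks whose starting letters are both moved by \<open>h\<close>, so t is unchanged and
      the number of crossing pairs rises by one.\<close>
    have second: "?f (m + (l - Suc j))
       = catalan_wt g j * (\<Sum>k<L. t ^ Suc k * (ballot_wt g m k * ballot_wt g (l - 1 - j) k))"
      if "j < l" for j
    proof -
      define i where "i = l - Suc j"
      have i: "i < l" "l - Suc i = j" "l - i = Suc j" using that by (auto simp: i_def)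
      have nth: "?w ! (m + i) = (h ^^ j) d"
        using i that by (simp add: nth_append rev_nth nth_periodic_word)
      have tk: "take (m + i) ?w = periodic_word h (h b) m @ rev (periodic_word h ((h ^^ Suc j) d) i)"
        using i by (simp add: take_rev drop_periodic_word i_def[symmetric] del: funpow.simps)
      have dr: "drop (Suc (m + i)) ?w = rev (periodic_word h d j)"
        using i that by (simp add: drop_rev take_periodic_word)
      show ?thesis
      proof (cases "even j")
        case True
        have "lim_mean \<gamma> (periodic_word h (h b) m @ rev (periodic_word h (h d) (l - Suc j)))
          = (\<Sum>k<L. t ^ k * (ballot_wt g m k * ballot_wt g (l - Suc j) k))"
          using less.hyps[of m "l - Suc j" "h b" "h d"] less.prems Suc by (simp add: t_def)
        then show ?thesis
          unfolding i_def[symmetric] nth tk dr using True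
          by (simp add: i_def funpow_h lim_mean_rev_periodic_word t_def[symmetric] sum_distrib_left mult_ac del: funpow.simps)
      next
        case False
        then show ?thesis
          unfolding i_def[symmetric] nth tk dr by (simp add: lim_mean_rev_periodic_word catalan_wt_odd)
      qed
    qed
    obtain L' where L: "L = Suc L'" using less.prems by (cases L) auto
    have "lim_mean \<gamma> (periodic_word h b n @ rev (periodic_word h d l)) = (\<Sum>i<m + l. ?f i)"
      by (simp only: Suc periodic_word.simps append_Cons lim_mean.simps length_append length_rev length_periodic_word)
    also have "\<dots> = (\<Sum>i<m. ?f i) + (\<Sum>i<l. ?f (m + i))"
      by (rule sum_lessThan_add)
    also have "(\<Sum>i<l. ?f (m + i)) = (\<Sum>j<l. ?f (m + (l - Suc j)))"
      by (rule sum.nat_diff_reindex[symmetric])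
    also have "\<dots> = (\<Sum>j<l. catalan_wt g j * (\<Sum>k<L. t ^ Suc k * (ballot_wt g m k * ballot_wt g (l - 1 - j) k)))"
      by (intro sum.cong refl second) simp
    also have "\<dots> = (\<Sum>k<L. \<Sum>j<l. t ^ Suc k * (ballot_wt g m k * (catalan_wt g j * ballot_wt g (l - 1 - j) k)))"
      unfolding sum_distrib_left by (subst sum.swap) (simp only: mult_ac)
    also have "\<dots> = (\<Sum>k<L. t ^ Suc k * (ballot_wt g m k * ballot_wt g l (Suc k)))"
      unfolding ballot_wt_Suc_Suc by (simp only: sum_distrib_left)
    \<comment> \<open>The summand at \<open>k = L'\<close> vanishes since \<open>m < L'\<close>;
      dropping it makes room for the index shift.\<close>
    also have "\<dots> = (\<Sum>k<L'. t ^ Suc k * (ballot_wt g m k * ballot_wt g l (Suc k)))"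
      using less.prems by (simp add: L Suc ballot_wt_eq_0)
    also have "\<dots> = (\<Sum>k<L. t ^ k * ((if k = 0 then 0 else ballot_wt g m (k - 1)) * ballot_wt g l k))"
      unfolding L sum.lessThan_Suc_shift by simp
    also have "(\<Sum>i<m. ?f i) = (\<Sum>i<m. g * (catalan_wt g i * (\<Sum>k<L. t ^ k * (ballot_wt g (m - 1 - i) k * ballot_wt g l k))))"
      by (intro sum.cong refl first) simp
    also have "\<dots> = (\<Sum>k<L. \<Sum>i<m. t ^ k * (g * (catalan_wt g i * ballot_wt g (m - 1 - i) k) * ballot_wt g l k))"
      unfolding sum_distrib_left by (subst sum.swap) (simp only: mult_ac)
    also have "\<dots> = (\<Sum>k<L. t ^ k * (g * (\<Sum>i<m. catalan_wt g i * ballot_wt g (m - 1 - i) k) * ballot_wt g l k))"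
      by (simp only: sum_distrib_left sum_distrib_right)
    finally show ?thesis
      unfolding Suc ballot_wt_first t_def[symmetric]
      by (simp only: distrib_left distrib_right sum.distrib add.commute)
  qed
qed

text \<open>Constant words are palindromes, and so are alternating words of odd length, here q - 1
  with q even.\<close>

lemma rev_periodic_word_ident:
  assumes "q \<ge> 1" and "(\<forall>b. h b = b) \<or> even q"
  shows "rev (periodic_word h c (q - 1)) = periodic_word h c (q - 1)"
proof (cases "q = 1")
  case False
  then obtain r where "q = Suc (Suc r)"
    using assms(1) by (cases q; cases "q - 1") auto
  then have "(\<forall>b. h b = b) \<or> even (q - 1 - 1)"
    using assms(2) by simp
  then show ?thesis
    by (simp only: rev_periodic_word funpow_h_trivial)
qed simp

text \<open>A circle whose length fits the period stays periodic when opened at any letter. The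
  reversed form is the shape of the second block in \<open>lim_mean_two_periodic\<close>.\<close>

lemma cut_at_periodic_word:
  assumes "l < q" and "(\<forall>b. h b = b) \<or> even q"
  shows "cut_at l (periodic_word h d q) = rev (periodic_word h (h ((h ^^ l) d)) (q - 1))"
proof -
  define c where "c = (h ^^ Suc l) d"
  have "cut_at l (periodic_word h d q) = periodic_word h c (q - Suc l) @ periodic_word h d l"
    using assms(1) by (simp add: cut_at_def drop_periodic_word take_periodic_word c_def)
  also have "periodic_word h d l = periodic_word h ((h ^^ (q - Suc l)) c) l"
  proof -
    have "(h ^^ (q - Suc l)) c = (h ^^ (q - Suc l + Suc l)) d"
      unfolding c_def funpow_add comp_apply ..
    also have "q - Suc l + Suc l = q" using assms(1) by simp
    finally show ?thesis by (simp only: funpow_h_trivial[OF assms(2)])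
  qed
  also have "periodic_word h c (q - Suc l) @ periodic_word h ((h ^^ (q - Suc l)) c) l = periodic_word h c (q - 1)"
  proof -
    have "q - Suc l + l = q - 1" using assms(1) by simp
    then show ?thesis using periodic_word_add[of h c "q - Suc l" l] by (simp only:)
  qed
  also have "\<dots> = rev (periodic_word h c (q - 1))"
    by (rule rev_periodic_word_ident[symmetric]) (use assms in simp_all)
  finally show ?thesis unfolding c_def by simp
qed

text \<open>The first-letter recursion reproduces \<open>cbin_wt_rec\<close> in the first factor,
  while \<open>ballot_wt_cbin_wt\<close> produces the second. \<open>Suc k\<close> is the number of
  joining pairs, and \<open>L\<close> is a bound above \<open>p\<close> kept fixed in the induction.
  The value is the same for all \<open>b\<close> and \<open>d\<close>.\<close>

lemma lim_cov_periodic_word: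
  assumes "p < L" "q \<ge> 1" and "(\<forall>b. h b = b) \<or> even p \<and> even q"
  shows "lim_cov \<gamma> (periodic_word h b p) (periodic_word h d q)
    = (\<Sum>k<L. (\<gamma> ^ Suc k + 1) * real (Suc k) * (cbin_wt g p (Suc k) * cbin_wt g q (Suc k)))"
  using assms
proof (induction p arbitrary: b rule: less_induct)
  case (less p)
  define K where "K p = (\<Sum>k<L. (\<gamma> ^ Suc k + 1) * real (Suc k) * (cbin_wt g p (Suc k) * cbin_wt g q (Suc k)))" for p
  let ?v = "periodic_word h d q"
  define T where "T \<longleftrightarrow> (\<forall>b. h b = b)"
  have prem: "T \<or> even p \<and> even q" using less.prems(3) by (simp only: T_def)
  have T: "(h ^^ i) c = c" if "T \<or> even i" for i c
    using that unfolding T_def by (rule funpow_h_trivial)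
  show ?case
  proof (cases p)
    case 0
    then show ?thesis by (simp add: cbin_wt_at_0)
  next
    case (Suc n)
    let ?w = "periodic_word h (h b) n"
    have IH: "lim_cov \<gamma> (periodic_word h c i) ?v = K i" if "i < p" "T \<or> even i" for c i
    proof -
      have "T \<or> even i \<and> even q" using that(2) prem by argo
      then show ?thesis
        unfolding K_def using that(1) less.prems(1,2) by (intro less.IH) (simp_all only: T_def)
    qed
    have first: "straight_wt \<gamma> b (?w ! l) *
       (lim_mean \<gamma> (take l ?w) * lim_cov \<gamma> (drop (Suc l) ?w) ?v
      + lim_mean \<gamma> (drop (Suc l) ?w) * lim_cov \<gamma> (take l ?w) ?v)
      = g * (catalan_wt g l * K (n - Suc l)) + g * (catalan_wt g (n - Suc l) * K l)" if "l < n" for l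
    proof (cases "T \<or> even l")
      case True
      have "straight_wt \<gamma> b (?w ! l) = g"
        using that by (simp only: nth_periodic_word T[OF True] straight_wt_h)
      moreover have "T \<or> even (n - Suc l)"
        using True prem that unfolding Suc by (cases T) simp_all
      moreover have "take l ?w = periodic_word h (h b) l" "n - Suc l < p" "l < p"
        using that by (simp_all add: take_periodic_word Suc)
      ultimately show ?thesis
        using True by (simp only: drop_periodic_word lim_mean_periodic_word IH distrib_left)
    next
      \<comment> \<open>Here the word alternates, \<open>p\<close> is even and \<open>l\<close> odd,
        so both arcs have odd length and their means vanish.\<close>
      case False
      then have odd: "odd (n - Suc l)" "odd l"
        using prem that unfolding Suc by simp_all
      have "take l ?w = periodic_word h (h b) l" using that by (simp add: take_periodic_word)
      then show ?thesis
        by (simp only: drop_periodic_word lim_mean_periodic_word catalan_wt_odd[OF odd(1)] catalan_wt_odd[OF odd(2)]) simp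
    qed
    have second: "twisted_wt \<gamma> b (?v ! l) * lim_mean \<gamma> (?w @ word_transpose (cut_at l ?v))
      + straight_wt \<gamma> b (?v ! l) * lim_mean \<gamma> (?w @ cut_at l ?v)
      = (\<Sum>k<L. (\<gamma> ^ Suc k + 1) * (ballot_wt g n k * ballot_wt g (q - 1) k))" if "l < q" for l
    proof -
      define z where "z = (h ^^ l) d"
      have cut: "cut_at l ?v = rev (periodic_word h (h z) (q - 1))"
        unfolding z_def using prem by (intro cut_at_periodic_word that) (auto simp: T_def[symmetric])
      \<comment> \<open>The opened word is a palindrome, so transposing it only flips the
        letters.\<close>
      have tr: "word_transpose (cut_at l ?v) = rev (periodic_word h (h (\<not> z)) (q - 1))"
      proof -
        have "T \<or> even q" using prem by argo
        then have "rev (periodic_word h (h (\<not> z)) (q - 1)) = periodic_word h (h (\<not> z)) (q - 1)"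
          unfolding T_def by (rule rev_periodic_word_ident[OF less.prems(2)])
        then show ?thesis
          unfolding cut word_transpose_def by (simp only: rev_rev_ident map_Not_periodic_word h_Not)
      qed
      have v: "?v ! l = z" using that by (simp add: nth_periodic_word z_def)
      have n: "n < L" using less.prems Suc by simp
      \<comment> \<open>Of the two crossing weights one is \<gamma> and the other 1, whichever
        letter \<open>z\<close> is; together with the first joining pair they give \<gamma>^(k+1) +
        1.\<close>
      show ?thesis
        unfolding tr unfolding cut v lim_mean_two_periodic[OF n] sum_distrib_left sum.distrib[symmetric] straight_wt_h_h
        by (intro sum.cong refl) (auto simp: straight_wt_def twisted_wt_def algebra_simps)
    qed
    have "lim_cov \<gamma> (periodic_word h b p) ?v
      = (\<Sum>l<n. g * (catalan_wt g l * K (n - Suc l)) + g * (catalan_wt g (n - Suc l) * K l))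
      + (\<Sum>l<q. \<Sum>k<L. (\<gamma> ^ Suc k + 1) * (ballot_wt g n k * ballot_wt g (q - 1) k))"
      unfolding Suc periodic_word.simps lim_cov.simps length_periodic_word
      by (intro arg_cong2[of _ _ _ _ "(+)"] sum.cong refl first second) auto
    also have "(\<Sum>l<n. g * (catalan_wt g l * K (n - Suc l)) + g * (catalan_wt g (n - Suc l) * K l))
      = 2 * g * (\<Sum>l<n. catalan_wt g l * K (n - 1 - l))"
    proof -
      have "(\<Sum>l<n. g * (catalan_wt g (n - Suc l) * K l)) = (\<Sum>l<n. g * (catalan_wt g l * K (n - Suc l)))"
        by (subst sum.nat_diff_reindex[symmetric]) (auto intro!: sum.cong)
      then show ?thesis by (simp add: sum.distrib sum_distrib_left mult.assoc)
    qed
    also have "(\<Sum>l<n. catalan_wt g l * K (n - 1 - l)) = (\<Sum>k<L. \<Sum>l<n. (\<gamma> ^ Suc k + 1) * real (Suc k) *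
        (catalan_wt g l * cbin_wt g (n - 1 - l) (Suc k) * cbin_wt g q (Suc k)))"
      unfolding K_def sum_distrib_left by (subst sum.swap) (simp only: mult_ac)
    also have "\<dots> = (\<Sum>k<L. (\<gamma> ^ Suc k + 1) * real (Suc k) *
        ((\<Sum>l<n. catalan_wt g l * cbin_wt g (n - 1 - l) (Suc k)) * cbin_wt g q (Suc k)))"
      by (simp only: sum_distrib_left sum_distrib_right)
    \<comment> \<open>All letters of the second circle contribute equally; the resulting factor
      \<open>q\<close> turns its ballot weight into (k+1) times a central binomial weight.\<close>
    also have "(\<Sum>l<q. \<Sum>k<L. (\<gamma> ^ Suc k + 1) * (ballot_wt g n k * ballot_wt g (q - 1) k))
      = (\<Sum>k<L. (\<gamma> ^ Suc k + 1) * (ballot_wt g n k * (real q * ballot_wt g (q - 1) k)))"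
      by (simp add: sum_distrib_left mult_ac)
    also have "\<dots> = (\<Sum>k<L. (\<gamma> ^ Suc k + 1) * real (Suc k) * (ballot_wt g n k * cbin_wt g q (Suc k)))"
      unfolding ballot_wt_cbin_wt[OF less.prems(2)] by (simp only: mult_ac)
    also have "2 * g * (\<Sum>k<L. (\<gamma> ^ Suc k + 1) * real (Suc k) *
        ((\<Sum>l<n. catalan_wt g l * cbin_wt g (n - 1 - l) (Suc k)) * cbin_wt g q (Suc k)))
      + (\<Sum>k<L. (\<gamma> ^ Suc k + 1) * real (Suc k) * (ballot_wt g n k * cbin_wt g q (Suc k)))
      = (\<Sum>k<L. (\<gamma> ^ Suc k + 1) * real (Suc k) * (cbin_wt g p (Suc k) * cbin_wt g q (Suc k)))"
      unfolding Suc cbin_wt_rec sum_distrib_left[of "2 * g" _ "{..<L}"] sum.distrib[symmetric]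
      by (intro sum.cong refl) (simp only: distrib_left distrib_right mult_ac add_ac)
    finally show ?thesis .
  qed
qed

end

section \<open>Words as matrix products\<close>

primrec mat_word :: "real mat \<Rightarrow> bool list \<Rightarrow> real mat" where
  "mat_word A [] = 1\<^sub>m (dim_row A)"
| "mat_word A (b # w) = (if b then A else transpose_mat A) * mat_word A w"

lemma mat_word_carrier: "A \<in> carrier_mat N N \<Longrightarrow> mat_word A w \<in> carrier_mat N N"
  by (induction w) auto

lemma mat_word_append:
  assumes "A \<in> carrier_mat N N"
  shows "mat_word A (u @ v) = mat_word A u * mat_word A v"
proof (induction u)
  case Nil
  then show ?case using assms mat_word_carrier[OF assms, of v] by simp
next
  case (Cons b u)
  have "(if b then A else transpose_mat A) \<in> carrier_mat N N" using assms by simp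
  from assoc_mult_mat[OF this mat_word_carrier[OF assms] mat_word_carrier[OF assms]]
  show ?case by (simp add: Cons.IH)
qed

lemma mat_word_pow:
  assumes "A \<in> carrier_mat N N"
  shows "mat_word A u ^\<^sub>m p = mat_word A (concat (replicate p u))"
proof (induction p)
  case 0
  then show ?case using mat_word_carrier[OF assms, of u] assms by simp
next
  case (Suc p)
  have "concat (replicate p u) @ u = concat (replicate (Suc p) u)"
    using replicate_append_same[of p u] by (metis concat_append concat.simps append_Nil2 replicate_Suc)
  then show ?case using mat_word_append[OF assms] Suc by (metis pow_mat.simps(2))
qed

lemma concat_replicate_single: "concat (replicate p [b]) = periodic_word id b p"
  by (induction p) simp_all

lemma concat_replicate_alternating: "concat (replicate p [True, False]) = periodic_word Not True (2 * p)"
  by (induction p) simp_all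

lemma mat_pow_word:
  assumes "A \<in> carrier_mat N N"
  shows "A ^\<^sub>m p = mat_word A (periodic_word id True p)"
    and "transpose_mat A ^\<^sub>m p = mat_word A (periodic_word id False p)"
    and "(A * transpose_mat A) ^\<^sub>m p = mat_word A (periodic_word Not True (2 * p))"
proof -
  have "mat_word A [True] = A" "mat_word A [False] = transpose_mat A"
    "mat_word A [True, False] = A * transpose_mat A"
    using assms by auto
  then show "A ^\<^sub>m p = mat_word A (periodic_word id True p)"
    "transpose_mat A ^\<^sub>m p = mat_word A (periodic_word id False p)"
    "(A * transpose_mat A) ^\<^sub>m p = mat_word A (periodic_word Not True (2 * p))"
    using mat_word_pow[OF assms, of "[True]" p] mat_word_pow[OF assms, of "[False]" p]
      mat_word_pow[OF assms, of "[True, False]" p]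
    by (simp_all only: concat_replicate_single concat_replicate_alternating)
qed

context gaussian_words begin

lemma mat_word_entry:
  assumes A: "A \<in> carrier_mat N N" and y: "\<And>i j. i < N \<Longrightarrow> j < N \<Longrightarrow> A $$ (i, j) = y (i, j) \<omega>"
  shows "i < N \<Longrightarrow> j < N \<Longrightarrow> mat_word A w $$ (i, j) = word_entry w i j \<omega>"
proof (induction w arbitrary: i)
  case Nil
  then show ?case using A by simp
next
  case (Cons b w)
  let ?B = "if b then A else transpose_mat A"
  have B: "?B \<in> carrier_mat N N" using A by simp
  have "mat_word A (b # w) $$ (i, j) = (\<Sum>k<N. ?B $$ (i, k) * mat_word A w $$ (k, j))"
    using B mat_word_carrier[OF A, of w] Cons.prems
    by (simp add: times_mat_def scalar_prod_def atLeast0LessThan)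
  also have "\<dots> = word_entry (b # w) i j \<omega>"
    using Cons A by (simp add: letter_pos_def y)
  finally show ?case .
qed

lemma tr_mat_word:
  assumes "A \<in> carrier_mat N N" and "\<And>i j. i < N \<Longrightarrow> j < N \<Longrightarrow> A $$ (i, j) = y (i, j) \<omega>"
  shows "tr (mat_word A w) = word_trace w \<omega>"
  using mat_word_carrier[OF assms(1), of w] mat_word_entry[OF assms]
  by (simp add: tr_def word_trace_def)

lemma kappa2_word_trace: "kappa2 M (word_trace w) (word_trace v) = centred_moment [w, v]"
  using expectation_trace_trace_centred[of w v "[]"]
  by (simp add: kappa2_def centred_moment_single centred_moment_Nil expectation_word_trace)

end

lemma kappa2_cong:
  "(\<And>\<omega>. \<omega> \<in> space M \<Longrightarrow> Y \<omega> = Y' \<omega>) \<Longrightarrow> (\<And>\<omega>. \<omega> \<in> space M \<Longrightarrow> Z \<omega> = Z' \<omega>) \<Longrightarrow> kappa2 M Y Z = kappa2 M Y' Z'"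
  unfolding kappa2_def
  by (intro arg_cong2[of _ _ _ _ "(-)"] arg_cong2[of _ _ _ _ "(*)"] Bochner_Integration.integral_cong) auto

lemma kappa2_words_tendsto:
  assumes X: "\<And>N. N \<ge> 1 \<Longrightarrow> normalized_gaussian_elliptic (M N) \<gamma> N (X N)"
  shows "(\<lambda>N. kappa2 (M N) (\<lambda>\<omega>. tr (mat_word (X N \<omega>) w)) (\<lambda>\<omega>. tr (mat_word (X N \<omega>) v))) \<longlonglongrightarrow> lim_cov \<gamma> w v"
proof -
  have "\<forall>N. \<exists>Y. N \<ge> 1 \<longrightarrow> gaussian_elliptic (M N) \<gamma> N Y \<and> (\<forall>\<omega>\<in>space (M N). X N \<omega> = (1 / sqrt (real N)) \<cdot>\<^sub>m Y \<omega>)"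
    using X unfolding normalized_gaussian_elliptic_def by blast
  then obtain Y where Y: "\<And>N. N \<ge> 1 \<Longrightarrow> gaussian_elliptic (M N) \<gamma> N (Y N)"
    and XY: "\<And>N \<omega>. N \<ge> 1 \<Longrightarrow> \<omega> \<in> space (M N) \<Longrightarrow> X N \<omega> = (1 / sqrt (real N)) \<cdot>\<^sub>m Y N \<omega>"
    by metis
  define y where "y N = (\<lambda>e \<omega>. 1 / sqrt (real N) * Y N \<omega> $$ e)" for N
  have W: "gaussian_words (M N) \<gamma> N (y N)" if "N \<ge> 1" for N
    unfolding y_def by (rule gaussian_elliptic_words[OF Y[OF that] that])
  define J where "J n = gaussian_words.centred_moment (M (Suc n)) (Suc n) (y (Suc n))" for n
  define m where "m n = gaussian_words.mean_trace (M (Suc n)) (Suc n) (y (Suc n))" for n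
  have "loop_equations \<gamma> m J"
  proof
    fix n x w vs
    interpret gaussian_words "M (Suc n)" \<gamma> "Suc n" "y (Suc n)" by (rule W) simp
    show "m n [] = 1" "J n [] = 1" "J n ([] # vs) = 0"
      by (simp_all add: m_def J_def mean_trace_Nil centred_moment_Nil centred_moment_Nil_Cons)
    show "m n (x # w) =
      (\<Sum>l<length w. straight_wt \<gamma> x (w ! l) * (J n [take l w, drop (Suc l) w] / real (Suc n) / real (Suc n)
         + m n (take l w) * m n (drop (Suc l) w))
     + twisted_wt \<gamma> x (w ! l) * (m n (word_transpose (take l w) @ drop (Suc l) w) / real (Suc n)))"
      unfolding m_def J_def by (rule mean_trace_Cons)
    show "J n ((x # w) # vs) =
    (\<Sum>l<length w.
       straight_wt \<gamma> x (w ! l) * ((J n (take l w # drop (Suc l) w # vs)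
            - J n [take l w, drop (Suc l) w] * J n vs) / real (Suc n)
         + m n (take l w) * J n (drop (Suc l) w # vs)
         + m n (drop (Suc l) w) * J n (take l w # vs))
     + twisted_wt \<gamma> x (w ! l) * (J n ((word_transpose (take l w) @ drop (Suc l) w) # vs) / real (Suc n)))
    + (\<Sum>j<length vs. \<Sum>l<length (vs ! j).
     twisted_wt \<gamma> x (vs ! j ! l) *
       (J n ((w @ word_transpose (cut_at l (vs ! j))) # skip_nth j vs) / real (Suc n)
      + m n (w @ word_transpose (cut_at l (vs ! j))) * J n (skip_nth j vs))
   + straight_wt \<gamma> x (vs ! j ! l) *
       (J n ((w @ cut_at l (vs ! j)) # skip_nth j vs) / real (Suc n)
      + m n (w @ cut_at l (vs ! j)) * J n (skip_nth j vs)))"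
      unfolding m_def J_def by (rule centred_moment_Cons[unfolded splice_term_def])
  qed
  then have lim: "(\<lambda>n. J n [w, v]) \<longlonglongrightarrow> lim_cov \<gamma> w v"
    by (rule loop_equations.J_tendsto)
  have eq: "J n [w, v] = kappa2 (M (Suc n)) (\<lambda>\<omega>. tr (mat_word (X (Suc n) \<omega>) w)) (\<lambda>\<omega>. tr (mat_word (X (Suc n) \<omega>) v))" for n
  proof -
    interpret gaussian_words "M (Suc n)" \<gamma> "Suc n" "y (Suc n)" by (rule W) simp
    have tr: "tr (mat_word (X (Suc n) \<omega>) u) = word_trace u \<omega>" if \<omega>: "\<omega> \<in> space (M (Suc n))" for u \<omega>
    proof (rule tr_mat_word)
      have "Y (Suc n) \<omega> \<in> carrier_mat (Suc n) (Suc n)"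
        using Y[of "Suc n"] \<omega> by (simp add: gaussian_elliptic_def)
      then show "X (Suc n) \<omega> \<in> carrier_mat (Suc n) (Suc n)"
        "i < Suc n \<Longrightarrow> j < Suc n \<Longrightarrow> X (Suc n) \<omega> $$ (i, j) = y (Suc n) (i, j) \<omega>" for i j
        using XY[OF _ \<omega>] by (auto simp: y_def)
    qed
    show ?thesis
      unfolding J_def kappa2_word_trace[symmetric] by (rule kappa2_cong) (simp_all add: tr)
  qed
  show ?thesis
    using lim unfolding eq
      filterlim_sequentially_Suc[of "\<lambda>N. kappa2 (M N) (\<lambda>\<omega>. tr (mat_word (X N \<omega>) w)) (\<lambda>\<omega>. tr (mat_word (X N \<omega>) v))"] .
qed

section \<open>The closed formulas\<close>

lemma binom_half_diff:
  assumes "a \<le> p"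
  shows "binom p ((real p - real a) / 2) = (if even (p - a) then real (p choose ((p - a) div 2)) else 0)"
proof (cases "even (p - a)")
  case True
  then obtain c where c: "p - a = 2 * c" by (rule evenE)
  then have "(real p - real a) / 2 = real c" using assms by (simp add: of_nat_diff[symmetric] del: of_nat_diff)
  then show ?thesis by (simp add: binom_def c)
next
  case False
  have "(real p - real a) / 2 \<notin> \<nat>"
  proof
    assume "(real p - real a) / 2 \<in> \<nat>"
    then obtain c where "(real p - real a) / 2 = real c" by (auto elim: Nats_cases)
    then have "real (p - a) = real (2 * c)" using assms by simp
    then have "p - a = 2 * c" by (simp only: of_nat_eq_iff)
    then show False using False by simp
  qed
  then show ?thesis using False by (simp add: binom_def)
qed

text \<open>The weights vanish for \<open>a\<close> beyond p or q, which trims the range. The powers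
  of \<gamma> combine as (p-a)/2 + (q-a)/2 = (p+q)/2 - a; if p + q is odd, the rounding in
  \<open>div\<close> touches only zero summands.\<close>

lemma sum_cbin_wt:
  "(\<Sum>k<Suc p. (\<gamma> ^ Suc k + 1) * real (Suc k) * (cbin_wt \<gamma> p (Suc k) * cbin_wt \<gamma> q (Suc k)))
   = (\<Sum>a=1..min p q. real a * \<gamma> ^ ((p + q) div 2 - a) * (\<gamma> ^ a + 1)
        * binom p ((real p - real a) / 2) * binom q ((real q - real a) / 2))"
proof -
  let ?f = "\<lambda>a. (\<gamma> ^ a + 1) * real a * (cbin_wt \<gamma> p a * cbin_wt \<gamma> q a)"
  have "(\<Sum>k<Suc p. ?f (Suc k)) = (\<Sum>a=1..Suc p. ?f a)"
    by (simp only: sum.atLeast1_atMost_eq One_nat_def)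
  also have "\<dots> = (\<Sum>a=1..min p q. ?f a)"
    by (intro sum.mono_neutral_right) (auto simp: cbin_wt_closed)
  also have "\<dots> = (\<Sum>a=1..min p q. real a * \<gamma> ^ ((p + q) div 2 - a) * (\<gamma> ^ a + 1)
        * binom p ((real p - real a) / 2) * binom q ((real q - real a) / 2))"
  proof (rule sum.cong[OF refl])
    fix a assume "a \<in> {1..min p q}"
    then have a: "a \<le> p" "a \<le> q" by auto
    show "?f a = real a * \<gamma> ^ ((p + q) div 2 - a) * (\<gamma> ^ a + 1)
        * binom p ((real p - real a) / 2) * binom q ((real q - real a) / 2)"
    proof (cases "even (p - a) \<and> even (q - a)")
      case True
      obtain c where "p - a = 2 * c" using True by (blast elim: evenE)
      moreover obtain d where "q - a = 2 * d" using True by (blast elim: evenE)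
      ultimately have "p = a + 2 * c" "q = a + 2 * d" using a by auto
      then have "(p + q) div 2 - a = (p - a) div 2 + (q - a) div 2" by simp
      then show ?thesis using a True
        by (simp add: cbin_wt_closed binom_half_diff power_add mult_ac)
    next
      case False
      then show ?thesis using a by (auto simp: cbin_wt_closed binom_half_diff)
    qed
  qed
  finally show ?thesis .
qed

text \<open>Between words of lengths 2p and 2q the number of joining pairs is even, so it is written
  as 2a: the source of the factor 2a and of \<gamma>^(2a). Since g = 1, no other power of \<gamma>
  occurs.\<close>

lemma sum_cbin_wt_even:
  "(\<Sum>k<Suc (2 * p). (\<gamma> ^ Suc k + 1) * real (Suc k) * (cbin_wt 1 (2 * p) (Suc k) * cbin_wt 1 (2 * q) (Suc k)))
   = (\<Sum>a=1..min p q. 2 * real a * (\<gamma> ^ (2 * a) + 1)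
        * real ((2 * p) choose (p - a)) * real ((2 * q) choose (q - a)))"
proof -
  let ?f = "\<lambda>a. (\<gamma> ^ a + 1) * real a * (cbin_wt 1 (2 * p) a * cbin_wt 1 (2 * q) a)"
  have "(\<Sum>k<Suc (2 * p). ?f (Suc k)) = (\<Sum>a=1..Suc (2 * p). ?f a)"
    by (simp only: sum.atLeast1_atMost_eq One_nat_def)
  also have "\<dots> = (\<Sum>a\<in>(*) 2 ` {1..min p q}. ?f a)"
  proof (rule sum.mono_neutral_right)
    show "\<forall>a\<in>{1..Suc (2 * p)} - (*) 2 ` {1..min p q}. ?f a = 0"
    proof
      fix a assume a: "a \<in> {1..Suc (2 * p)} - (*) 2 ` {1..min p q}"
      show "?f a = 0"
      proof (cases "even a")
        case True
        then obtain c where "a = 2 * c" by (rule evenE)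
        with a have "c > min p q" by auto
        then show ?thesis using \<open>a = 2 * c\<close> by (auto simp: cbin_wt_closed min_def split: if_splits)
      next
        case False
        then show ?thesis by (auto simp: cbin_wt_closed)
      qed
    qed
  qed auto
  also have "\<dots> = (\<Sum>a=1..min p q. ?f (2 * a))"
    by (subst sum.reindex) (auto simp: inj_on_def)
  also have "\<dots> = (\<Sum>a=1..min p q. 2 * real a * (\<gamma> ^ (2 * a) + 1)
        * real ((2 * p) choose (p - a)) * real ((2 * q) choose (q - a)))"
  proof (rule sum.cong[OF refl])
    fix a assume "a \<in> {1..min p q}"
    moreover have "(2 * r - 2 * a) div 2 = r - a" for r :: nat
      by (simp flip: diff_mult_distrib2)
    ultimately show "?f (2 * a) = 2 * real a * (\<gamma> ^ (2 * a) + 1)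
        * real ((2 * p) choose (p - a)) * real ((2 * q) choose (q - a))"
      by (simp add: cbin_wt_closed)
  qed
  finally show ?thesis .
qed

theorem theorem1p7:
  fixes \<gamma> :: real
    and M :: "nat \<Rightarrow> 'a measure"
    and X :: "nat \<Rightarrow> 'a \<Rightarrow> real mat"
    and p q :: nat
  assumes "-1 \<le> \<gamma>" and "\<gamma> \<le> 1"
    and "\<And>N. N \<ge> 1 \<Longrightarrow> normalized_gaussian_elliptic (M N) \<gamma> N (X N)"
    and "p \<ge> 1" and "q \<ge> 1"
  shows "((\<lambda>N. kappa2 (M N) (\<lambda>\<omega>. tr (X N \<omega> ^\<^sub>m p)) (\<lambda>\<omega>. tr (X N \<omega> ^\<^sub>m q)))
           \<longlonglongrightarrow> (\<Sum>a=1..min p q. real a * \<gamma> ^ ((p + q) div 2 - a) * (\<gamma> ^ a + 1)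
                 * binom p ((real p - real a) / 2) * binom q ((real q - real a) / 2))) \<and>
         ((\<lambda>N. kappa2 (M N) (\<lambda>\<omega>. tr (X N \<omega> ^\<^sub>m p)) (\<lambda>\<omega>. tr ((transpose_mat (X N \<omega>)) ^\<^sub>m q)))
           \<longlonglongrightarrow> (\<Sum>a=1..min p q. real a * \<gamma> ^ ((p + q) div 2 - a) * (\<gamma> ^ a + 1)
                 * binom p ((real p - real a) / 2) * binom q ((real q - real a) / 2))) \<and>
         ((\<lambda>N. kappa2 (M N) (\<lambda>\<omega>. tr ((X N \<omega> * transpose_mat (X N \<omega>)) ^\<^sub>m p))
                             (\<lambda>\<omega>. tr ((X N \<omega> * transpose_mat (X N \<omega>)) ^\<^sub>m q)))
           \<longlonglongrightarrow> (\<Sum>a=1..min p q. 2 * real a * (\<gamma> ^ (2 * a) + 1)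
                 * real ((2 * p) choose (p - a)) * real ((2 * q) choose (q - a))))"
proof -
  note lim = kappa2_words_tendsto[of M \<gamma> X, OF assms(3)]
  have carrier: "X N \<omega> \<in> carrier_mat N N" if "N \<ge> 1" "\<omega> \<in> space (M N)" for N \<omega>
    using assms(3)[OF that(1)] that(2)
    by (auto simp: normalized_gaussian_elliptic_def gaussian_elliptic_def)
  \<comment> \<open>Nothing is assumed about size N = 0, so the matrix identities are used only from
    N = 1 on.\<close>
  have words: "(\<lambda>N. kappa2 (M N) (\<lambda>\<omega>. tr (F (X N \<omega>))) (\<lambda>\<omega>. tr (G (X N \<omega>)))) \<longlonglongrightarrow> lim_cov \<gamma> w v"
    if F: "\<And>N A. A \<in> carrier_mat N N \<Longrightarrow> F A = mat_word A w"
      and G: "\<And>N A. A \<in> carrier_mat N N \<Longrightarrow> G A = mat_word A v" for F G w v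
  proof (rule Lim_transform_eventually[OF lim])
    show "\<forall>\<^sub>F N in sequentially. kappa2 (M N) (\<lambda>\<omega>. tr (mat_word (X N \<omega>) w)) (\<lambda>\<omega>. tr (mat_word (X N \<omega>) v))
      = kappa2 (M N) (\<lambda>\<omega>. tr (F (X N \<omega>))) (\<lambda>\<omega>. tr (G (X N \<omega>)))"
      using eventually_ge_at_top[of 1]
    proof eventually_elim
      case (elim N)
      show ?case
        by (rule kappa2_cong) (simp_all add: F[OF carrier[OF elim]] G[OF carrier[OF elim]])
    qed
  qed
  interpret pure: periodic_letters id \<gamma> \<gamma> by unfold_locales simp
  interpret alternating: periodic_letters Not \<gamma> 1 by unfold_locales simp
  \<comment> \<open>\<open>d\<close> is \<open>True\<close> for powers of X and \<open>False\<close>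
    for powers of the transpose; one formula serves both.\<close>
  have pure_eq: "lim_cov \<gamma> (periodic_word id True p) (periodic_word id d q)
    = (\<Sum>a=1..min p q. real a * \<gamma> ^ ((p + q) div 2 - a) * (\<gamma> ^ a + 1)
        * binom p ((real p - real a) / 2) * binom q ((real q - real a) / 2))" for d
    using assms(5) by (subst pure.lim_cov_periodic_word[of p "Suc p" q]) (simp_all only: sum_cbin_wt lessI id_apply simp_thms)
  have alternating_eq: "lim_cov \<gamma> (periodic_word Not True (2 * p)) (periodic_word Not True (2 * q))
    = (\<Sum>a=1..min p q. 2 * real a * (\<gamma> ^ (2 * a) + 1)
        * real ((2 * p) choose (p - a)) * real ((2 * q) choose (q - a)))"
    using assms(5) by (subst alternating.lim_cov_periodic_word[of "2 * p" "Suc (2 * p)" "2 * q"])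
      (simp_all only: sum_cbin_wt_even lessI, simp_all)
  show ?thesis
    using words[where F = "\<lambda>A. A ^\<^sub>m p" and G = "\<lambda>A. A ^\<^sub>m q", OF mat_pow_word(1) mat_pow_word(1)]
      words[where F = "\<lambda>A. A ^\<^sub>m p" and G = "\<lambda>A. transpose_mat A ^\<^sub>m q", OF mat_pow_word(1) mat_pow_word(2)]
      words[where F = "\<lambda>A. (A * transpose_mat A) ^\<^sub>m p" and G = "\<lambda>A. (A * transpose_mat A) ^\<^sub>m q",
        OF mat_pow_word(3) mat_pow_word(3)]
    unfolding pure_eq alternating_eq by (intro conjI)
qed

end
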